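(* (1) For any function $\rho:\mathbb{N}\to\mathbb{N}$ tending to infinity, there exists a monotone class of graphs with expansion at most $r\mapsto\rho(r)$ that is not ADT sketchable. (2) For any $\varepsilon>0$, there exists a monotone class $\mathcal{F}$ with expansion $r\mapsto O(r^\varepsilon)$ such that, if $\mathcal{F}$ admits an $\alpha$-ADT sketch of size $s(n)$, then $s(n)=n^{\Omega(1/\alpha)}$.
   Context: A class of graphs is a set of finite graphs closed under isomorphism; monotone means closed under subgraphs. A depth-$r$ minor of $G$ is obtained from a subgraph of $G$ by contracting pairwise disjoint connected subgraphs of radius at most $r$; a class has expansion at most $f$ if every depth-$r$ minor of any of its graphs has average degree at most $f(r)$. An $\alpha$-ADT sketch of size $s(n)$: for every $r\in\mathbb{N}$ a function $D_r:\{0,1\}^*\times\{0,1\}^*\to\{0,1\}$ such that every $n$-vertex $G\in\mathcal{F}$ has a distribution over $\mathsf{sk}:V(G)\to\{0,1\}^{s(n)}$ with, for all $x,y$: $\mathsf{dist}_G(x,y)\le r\Rightarrow\Pr[D_r(\mathsf{sk}(x),\mathsf{sk}(y))=1]\ge2/3$, and $\mathsf{dist}_G(x,y)>\alpha r\Rightarrow\Pr[D_r(\mathsf{sk}(x),\mathsf{sk}(y))=0]\ge2/3$. A class is ADT sketchable if for some $\alpha>1$ it has an $\alpha$-ADT sketch whose size is a constant (independent of $n$ and $r$).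
   Formalization: Part (1) is stated for ρ tending to infinity with ρ(r) ≥ 3 for every r; if ρ(r) ≤ 2 for some r, all graphs in the class have at most one cycle per component (none has an edge if ρ(r) = 0), so the class is ADT sketchable and the claim fails. *)

theory Defs
  imports
    "HOL-Probability.Probability"
    "HOL-Library.Landau_Symbols"
    "HOL-Library.Extended_Nat"
begin

record 'a ugraph =
  verts :: "'a set"
  edges :: "'a set set"

definition finite_simple_graph :: "'a ugraph \<Rightarrow> bool" where
  "finite_simple_graph G \<longleftrightarrow>
     finite (verts G) \<and> (\<forall>e\<in>edges G. e \<subseteq> verts G \<and> card e = 2)"

definition isomorphic :: "'a ugraph \<Rightarrow> 'b ugraph \<Rightarrow> bool" where
  "isomorphic G H \<longleftrightarrow>
     (\<exists>\<phi>. bij_betw \<phi> (verts G) (verts H) \<and> edges H = (\<lambda>e. \<phi> ` e) ` edges G)"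

definition subgraph :: "'a ugraph \<Rightarrow> 'a ugraph \<Rightarrow> bool" where
  "subgraph H G \<longleftrightarrow>
     finite_simple_graph H \<and> verts H \<subseteq> verts G \<and> edges H \<subseteq> edges G"

definition adj :: "'a ugraph \<Rightarrow> 'a rel" where
  "adj G = {(u, v). {u, v} \<in> edges G}"

text \<open>The least length of a walk; vertices in different components are at distance
  \<^term>\<open>\<infinity>\<close>, being the infimum of the empty set.\<close>
definition gdist :: "'a ugraph \<Rightarrow> 'a \<Rightarrow> 'a \<Rightarrow> enat" where
  "gdist G x y = (INF n\<in>{n. (x, y) \<in> adj G ^^ n}. enat n)"

definition connected_graph :: "'a ugraph \<Rightarrow> bool" where
  "connected_graph G \<longleftrightarrow>
     verts G \<noteq> {} \<and> (\<forall>x\<in>verts G. \<forall>y\<in>verts G. gdist G x y \<noteq> \<infinity>)"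

definition radius :: "'a ugraph \<Rightarrow> enat" where
  "radius G = (INF c\<in>verts G. SUP v\<in>verts G. gdist G c v)"

definition degree :: "'a ugraph \<Rightarrow> 'a \<Rightarrow> nat" where
  "degree G v = card {e \<in> edges G. v \<in> e}"

definition average_degree :: "'a ugraph \<Rightarrow> real" where
  "average_degree G = (\<Sum>v\<in>verts G. real (degree G v)) / real (card (verts G))"

text \<open>Contraction of a family \<open>S\<close> of vertex-disjoint subgraphs of \<open>G\<close>. A vertex of the
  result is the set of vertices of \<open>G\<close> merged into it, a singleton for each vertex outside
  the contracted subgraphs; loops and parallel edges are discarded.\<close>
definition contract :: "'a ugraph \<Rightarrow> 'a ugraph set \<Rightarrow> 'a set ugraph" where
  "contract G S =
     (let P = verts ` S \<union> (\<lambda>v. {v}) ` (verts G - (\<Union>K\<in>S. verts K)) in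
      \<lparr>verts = P,
       edges = {{A, B} |A B. A \<in> P \<and> B \<in> P \<and> A \<noteq> B \<and>
                             (\<exists>a\<in>A. \<exists>b\<in>B. {a, b} \<in> edges G)}\<rparr>)"

definition depth_minor :: "nat \<Rightarrow> 'a ugraph \<Rightarrow> 'a set ugraph \<Rightarrow> bool" where
  "depth_minor r G H \<longleftrightarrow>
     (\<exists>G' S. subgraph G' G \<and>
        (\<forall>K\<in>S. subgraph K G' \<and> connected_graph K \<and> radius K \<le> enat r) \<and>
        pairwise (\<lambda>K L. disjnt (verts K) (verts L)) S \<and>
        H = contract G' S)"

text \<open>Vertices are natural numbers: every finite graph has an isomorphic copy of this
  kind, and a class contains all such copies of its members.\<close>
definition graph_class :: "nat ugraph set \<Rightarrow> bool" where
  "graph_class F \<longleftrightarrow>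
     (\<forall>G\<in>F. finite_simple_graph G) \<and>
     (\<forall>G\<in>F. \<forall>H. finite_simple_graph H \<and> isomorphic G H \<longrightarrow> H \<in> F)"

definition monotone_class :: "nat ugraph set \<Rightarrow> bool" where
  "monotone_class F \<longleftrightarrow>
     graph_class F \<and> (\<forall>G\<in>F. \<forall>H. subgraph H G \<longrightarrow> H \<in> F)"

definition expansion_at_most :: "nat ugraph set \<Rightarrow> (nat \<Rightarrow> real) \<Rightarrow> bool" where
  "expansion_at_most F f \<longleftrightarrow>
     (\<forall>r. \<forall>G\<in>F. \<forall>H. depth_minor r G H \<longrightarrow> average_degree H \<le> f r)"

text \<open>The decoder \<open>D\<close> depends on \<open>r\<close> only; the distribution \<open>p\<close> of the random sketch
  may depend on both \<open>r\<close> and \<open>G\<close>. Bit strings are Boolean lists.\<close>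
definition has_ADT_sketch :: "nat ugraph set \<Rightarrow> real \<Rightarrow> (nat \<Rightarrow> nat) \<Rightarrow> bool" where
  "has_ADT_sketch F \<alpha> s \<longleftrightarrow>
     (\<forall>r::nat. \<exists>D :: bool list \<Rightarrow> bool list \<Rightarrow> bool. \<forall>G\<in>F.
        \<exists>p :: (nat \<Rightarrow> bool list) pmf.
          set_pmf p \<subseteq> verts G \<rightarrow>\<^sub>E {w. length w = s (card (verts G))} \<and>
          (\<forall>x\<in>verts G. \<forall>y\<in>verts G.
             (gdist G x y \<le> enat r \<longrightarrow>
                measure_pmf.prob p {sk. D (sk x) (sk y)} \<ge> 2/3) \<and>
             (ereal_of_enat (gdist G x y) > ereal (\<alpha> * real r) \<longrightarrow>
                measure_pmf.prob p {sk. \<not> D (sk x) (sk y)} \<ge> 2/3)))"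

definition ADT_sketchable :: "nat ugraph set \<Rightarrow> bool" where
  "ADT_sketchable F \<longleftrightarrow> (\<exists>\<alpha>>1. \<exists>k. has_ADT_sketch F \<alpha> (\<lambda>_. k))"

end

theory Submission
  imports Defs "HOL-Real_Asymp.Real_Asymp"
begin

text \<open>The classes consist of all graphs that embed into the \<open>t\<^sub>N\<close>-subdivision of the complete
  graph on \<open>N\<close> vertices, for some \<open>N\<close>. A depth-\<open>r\<close> minor of such a graph has average degree at
  most \<open>N + 4\<close>, and at most 3 if \<open>r\<close> is small compared to \<open>t\<^sub>N\<close>: a blob without a branch vertex
  then has at most two neighbours, at most one of which contains a branch vertex, and blobs with
  branch vertices are not adjacent. So the expansion is controlled by the growth of \<open>t\<^sub>N\<close>.

  For the lower bound take a graph on \<open>N\<close> vertices with average degree \<open>\<Omega>(D)\<close> and no cycle of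
  length at most \<open>\<alpha> + 1\<close>, where \<open>D \<approx> N\<^bsup>1/\<alpha>\<^esup>\<close>. In the subdivision of any of its subgraphs the ends
  of an edge are at distance at most \<open>t\<close> if the edge is kept and more than \<open>\<alpha> t\<close> otherwise, so
  some outcome of the sketch recovers the subgraph up to a third of the edges. A subgraph is thus
  within this distance of one of \<open>2\<^bsup>N s\<^esup>\<close> decoded subgraphs, which forces \<open>s = \<Omega>(D)\<close>.\<close>

section \<open>Walks as powers of a relation\<close>

lemma sym_relpow:
  fixes R :: "'a rel"
  shows "sym R \<Longrightarrow> (x, y) \<in> R ^^ n \<Longrightarrow> (y, x) \<in> R ^^ n"
proof (induction n arbitrary: y)
  case (Suc n)
  then obtain z where "(x, z) \<in> R ^^ n" "(z, y) \<in> R" by auto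
  with Suc show ?case by (meson relpow_Suc_I2 symD)
qed auto

lemma relpow_mono:
  fixes R :: "'a rel"
  shows "R \<subseteq> S \<Longrightarrow> (x, y) \<in> R ^^ n \<Longrightarrow> (x, y) \<in> S ^^ n"
proof (induction n arbitrary: y)
  case (Suc n)
  then obtain z where "(x, z) \<in> R ^^ n" "(z, y) \<in> R" by auto
  with Suc show ?case by auto
qed auto

subsection \<open>Subdivisions and their shallow minors\<close>

datatype label = Branch nat | Inner nat nat nat

definition on_path :: "nat \<Rightarrow> nat \<Rightarrow> nat \<Rightarrow> nat \<Rightarrow> label" where
  "on_path t u v i = (if i = 0 then Branch u else if i = t then Branch v else Inner u v i)"

text \<open>Steps go in both directions, but \<open>E\<close> should hold each edge in one
  orientation only: \<open>Inner u v i\<close> and \<open>Inner v u i\<close> are different labels,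
  so a symmetric \<open>E\<close> would create two paths per edge.\<close>

definition subdivision :: "nat \<Rightarrow> nat rel \<Rightarrow> label rel" where
  "subdivision t E =
     {(on_path t u v i, on_path t u v j) |u v i j.
        (u, v) \<in> E \<and> i \<le> t \<and> j \<le> t \<and> (j = Suc i \<or> i = Suc j)}"

text \<open>The upward orientation gives one path per edge. The number of branch vertices is not
  bounded here; the bound on the branch labels in use is imposed separately.\<close>

abbreviation all_edges :: "nat rel" where
  "all_edges \<equiv> {(u, v). u < v}"

lemma subdivision_mono: "E \<subseteq> E' \<Longrightarrow> subdivision t E \<subseteq> subdivision t E'"
  unfolding subdivision_def by blast

lemma sym_subdivision: "sym (subdivision t E)"
  unfolding subdivision_def sym_def by blast

lemma subdivision_cases:
  assumes "(x, y) \<in> subdivision t E"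
  obtains u v i where "(u, v) \<in> E" "i < t"
      "x = on_path t u v i \<and> y = on_path t u v (Suc i) \<or>
       y = on_path t u v i \<and> x = on_path t u v (Suc i)"
  using assms unfolding subdivision_def by (auto simp: Suc_le_eq)

lemma on_path_inject:
  assumes "u < v" "i \<le> t" "j \<le> t" "on_path t u v i = on_path t u v j"
  shows "i = j"
  using assms by (auto simp: on_path_def split: if_splits)

lemma on_path_eq_Inner:
  assumes "on_path t u v i = Inner u' v' i'" "i \<le> t"
  shows "u' = u \<and> v' = v \<and> i' = i \<and> 0 < i \<and> i < t"
  using assms by (auto simp: on_path_def split: if_splits)

lemma subdivision_Inner:
  assumes "(Inner u v i, y) \<in> subdivision t E"
  shows "(u, v) \<in> E \<and> 0 < i \<and> i < t \<and> (y = on_path t u v (Suc i) \<or> y = on_path t u v (i - 1))"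
  using assms
proof (cases rule: subdivision_cases)
  case (1 u' v' j)
  from 1(3) show ?thesis
  proof
    assume *: "Inner u v i = on_path t u' v' j \<and> y = on_path t u' v' (Suc j)"
    then have "u = u' \<and> v = v' \<and> i = j \<and> 0 < j \<and> j < t"
      using on_path_eq_Inner[of t u' v' j u v i] 1 by simp
    with * 1 show ?thesis by simp
  next
    assume *: "y = on_path t u' v' j \<and> Inner u v i = on_path t u' v' (Suc j)"
    then have "u = u' \<and> v = v' \<and> i = Suc j \<and> Suc j < t"
      using on_path_eq_Inner[of t u' v' "Suc j" u v i] 1 by simp
    with * 1 show ?thesis by simp
  qed
qed

text \<open>The setting of a depth-\<open>r\<close> minor: \<open>P\<close> collects the vertex sets
  of the contracted pieces and the remaining singletons, \<phi> places the vertices in a subdivided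
  complete graph, and \<open>linked\<close> is what radius at most \<open>r\<close> leaves.
  Adjacency is that of the whole subdivision, which can only add neighbours.\<close>

locale blob_family =
  fixes t r :: nat and \<phi> :: "'a \<Rightarrow> label" and P :: "'a set set"
  assumes t_pos: "0 < t"
    and finite_blobs: "finite P"
    and disjoint_blobs: "A \<in> P \<Longrightarrow> B \<in> P \<Longrightarrow> x \<in> A \<Longrightarrow> x \<in> B \<Longrightarrow> A = B"
    and inj: "inj_on \<phi> (\<Union>P)"
    and linked: "A \<in> P \<Longrightarrow> x \<in> A \<Longrightarrow> y \<in> A \<Longrightarrow>
      \<exists>m\<le>2 * r. (x, y) \<in> (inv_image (subdivision t all_edges) \<phi> \<inter> A \<times> A) ^^ m"
begin

abbreviation Q :: "'a rel" where
  "Q \<equiv> inv_image (subdivision t all_edges) \<phi>"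

definition branch_blobs :: "'a set set" where
  "branch_blobs = {B \<in> P. \<exists>x\<in>B. \<exists>u. \<phi> x = Branch u}"

definition inner_blobs :: "'a set set" where
  "inner_blobs = P - branch_blobs"

definition nbrs :: "'a set \<Rightarrow> 'a set set" where
  "nbrs A = {B \<in> P. B \<noteq> A \<and> (\<exists>a\<in>A. \<exists>b\<in>B. (a, b) \<in> Q)}"

lemma inj_blobs: "A \<in> P \<Longrightarrow> B \<in> P \<Longrightarrow> x \<in> A \<Longrightarrow> y \<in> B \<Longrightarrow> \<phi> x = \<phi> y \<Longrightarrow> x = y"
  using inj by (auto dest: inj_onD)

text \<open>From an inner vertex a walk moves only to the next or the previous position of the path,
  so it meets no branch vertex before it has swept all positions up to one of the two ends. It may
  wander on from there, so \<open>w\<close> can differ from \<open>u\<close> and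
  \<open>v\<close>.\<close>

lemma walk_to_branch:
  assumes "(x, y) \<in> (Q \<inter> A \<times> A) ^^ m" "x \<in> A" "\<phi> x = on_path t u v i" "i \<le> t"
    and "\<phi> y = Branch w"
  shows "i \<le> m \<and> (\<forall>j\<le>i. on_path t u v j \<in> \<phi> ` A) \<or>
         t - i \<le> m \<and> (\<forall>j. i \<le> j \<and> j \<le> t \<longrightarrow> on_path t u v j \<in> \<phi> ` A)"
  using assms
proof (induction m arbitrary: x i)
  case 0
  then have "i = 0 \<or> i = t" by (auto simp: on_path_def split: if_splits)
  then show ?case using 0
    by (metis diff_is_0_eq eq_imp_le image_eqI le_antisym le_zero_eq zero_le)
next
  case (Suc m)
  have in_A: "on_path t u v i \<in> \<phi> ` A" using Suc.prems(2,3) by (metis image_eqI)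
  consider "i = 0" | "i = t" | "0 < i" "i < t" using Suc.prems(4) by linarith
  then show ?case
  proof cases
    case 1
    then show ?thesis using in_A by auto
  next
    case 2
    then show ?thesis using in_A by auto
  next
    case 3
    from Suc.prems(1) obtain x' where x': "(x, x') \<in> Q \<inter> A \<times> A" "(x', y) \<in> (Q \<inter> A \<times> A) ^^ m"
      by (meson relpow_Suc_D2)
    have "\<phi> x = Inner u v i" using 3 Suc.prems(3) by (simp add: on_path_def)
    then have "(Inner u v i, \<phi> x') \<in> subdivision t all_edges" using x' by simp
    from subdivision_Inner[OF this]
    have "\<phi> x' = on_path t u v (Suc i) \<or> \<phi> x' = on_path t u v (i - 1)" by simp
    then show ?thesis
    proof
      assume "\<phi> x' = on_path t u v (Suc i)"
      then consider "Suc i \<le> m" "\<forall>j\<le>Suc i. on_path t u v j \<in> \<phi> ` A" |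
         "t - Suc i \<le> m" "\<forall>j. Suc i \<le> j \<and> j \<le> t \<longrightarrow> on_path t u v j \<in> \<phi> ` A"
        using Suc.IH[of x' "Suc i"] x' 3 Suc.prems(5) by auto
      then show ?thesis
      proof cases
        case 1
        then show ?thesis by auto
      next
        case 2
        have "on_path t u v j \<in> \<phi> ` A" if "i \<le> j" "j \<le> t" for j
          using 2(2) in_A that by (cases "j = i") auto
        then show ?thesis using 2(1) by auto
      qed
    next
      assume "\<phi> x' = on_path t u v (i - 1)"
      then consider "i - 1 \<le> m" "\<forall>j\<le>i - 1. on_path t u v j \<in> \<phi> ` A" |
         "t - (i - 1) \<le> m" "\<forall>j. i - 1 \<le> j \<and> j \<le> t \<longrightarrow> on_path t u v j \<in> \<phi> ` A"
        using Suc.IH[OF x'(2) _ _ _ Suc.prems(5), of "i - 1"] x'(1) 3 by fastforce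
      then show ?thesis
      proof cases
        case 1
        have "on_path t u v j \<in> \<phi> ` A" if "j \<le> i" for j
          using 1(2) in_A that by (cases "j = i") auto
        then show ?thesis using 1(1) by auto
      next
        case 2
        then show ?thesis by auto
      qed
    qed
  qed
qed

text \<open>The walk inside \<open>B\<close> from \<open>y\<close> to a branch vertex cannot pass
  \<open>x\<close>, which lies in another blob, so within \<open>2 * r\<close> steps it reaches the
  end of the path on the side away from \<open>x\<close>.\<close>

lemma branch_blob_near_end:
  assumes A: "A \<in> P" and B: "B \<in> branch_blobs" and "A \<noteq> B" and x: "x \<in> A" and y: "y \<in> B"
    and "u < v" "i \<le> t" "j \<le> t" "\<phi> y = on_path t u v i" "\<phi> x = on_path t u v j"
  shows "(j = Suc i \<longrightarrow> i \<le> 2 * r) \<and> (i = Suc j \<longrightarrow> t - i \<le> 2 * r)"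
proof -
  have BP: "B \<in> P" using B by (simp add: branch_blobs_def)
  obtain z w where z: "z \<in> B" "\<phi> z = Branch w" using B by (auto simp: branch_blobs_def)
  obtain m where m: "m \<le> 2 * r" "(y, z) \<in> (Q \<inter> B \<times> B) ^^ m" using linked[OF BP y z(1)] by blast
  have "\<phi> x \<notin> \<phi> ` B"
    using inj_blobs[OF A BP x] disjoint_blobs[OF A BP x] \<open>A \<noteq> B\<close> by auto
  then show ?thesis
    using walk_to_branch[OF m(2) y \<open>\<phi> y = _\<close> \<open>i \<le> t\<close> z(2)] m(1) assms(7,8,10) by auto
qed

text \<open>Of two adjacent positions \<open>i\<close> and \<open>Suc i\<close>, the lower would be
  within \<open>2 * r\<close> of 0 and the upper within \<open>2 * r\<close> of \<open>t\<close>,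
  whence \<open>t \<le> 4 * r + 1\<close>.\<close>

lemma branch_blobs_independent:
  assumes "4 * r + 1 < t" "A \<in> branch_blobs"
  shows "nbrs A \<inter> branch_blobs = {}"
proof (rule ccontr)
  assume "nbrs A \<inter> branch_blobs \<noteq> {}"
  then obtain B a b where B: "B \<in> branch_blobs" "B \<noteq> A" "a \<in> A" "b \<in> B"
      and ab: "(\<phi> a, \<phi> b) \<in> subdivision t all_edges"
    by (auto simp: nbrs_def)
  have P: "A \<in> P" "B \<in> P" using assms B by (auto simp: branch_blobs_def)
  from ab obtain u v i where uv: "(u, v) \<in> all_edges" "i < t"
      and ab': "\<phi> a = on_path t u v i \<and> \<phi> b = on_path t u v (Suc i) \<or>
       \<phi> b = on_path t u v i \<and> \<phi> a = on_path t u v (Suc i)"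
    by (rule subdivision_cases)
  note near = branch_blob_near_end[OF P(1) B(1) B(2)[symmetric] B(3,4), of u v]
    branch_blob_near_end[OF P(2) assms(2) B(2) B(4,3), of u v]
  from ab' show False
  proof
    assume "\<phi> a = on_path t u v i \<and> \<phi> b = on_path t u v (Suc i)"
    then show False using near(1)[of "Suc i" i] near(2)[of i "Suc i"] assms(1) uv by auto
  next
    assume "\<phi> b = on_path t u v i \<and> \<phi> a = on_path t u v (Suc i)"
    then show False using near(2)[of "Suc i" i] near(1)[of i "Suc i"] assms(1) uv by auto
  qed
qed

text \<open>Without a branch vertex in the blob the walk never leaves the interior of its path, and
  its position changes by one at each step, so it visits everything in between.\<close>

lemma walk_in_inner_blob:
  assumes "(x, y) \<in> (Q \<inter> A \<times> A) ^^ m" "A \<in> inner_blobs" "x \<in> A"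
    and "\<phi> x = Inner u v i" "u < v" "0 < i" "i < t"
  shows "\<exists>j. \<phi> y = Inner u v j \<and> 0 < j \<and> j < t \<and> j \<le> i + m \<and> i \<le> j + m \<and>
    (\<forall>l. i \<le> l \<and> l \<le> j \<or> j \<le> l \<and> l \<le> i \<longrightarrow> Inner u v l \<in> \<phi> ` A)"
  using assms
proof (induction m arbitrary: x i)
  case 0
  then show ?case by (auto intro!: image_eqI[of _ \<phi> x])
next
  case (Suc m)
  have in_A: "Inner u v i \<in> \<phi> ` A" using Suc.prems(3,4) by (metis image_eqI)
  from Suc.prems(1) obtain x' where x': "(x, x') \<in> Q \<inter> A \<times> A" "(x', y) \<in> (Q \<inter> A \<times> A) ^^ m"
    by (meson relpow_Suc_D2)
  have "(Inner u v i, \<phi> x') \<in> subdivision t all_edges" using x' Suc.prems(4) by simp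
  from subdivision_Inner[OF this]
  obtain i' where i': "\<phi> x' = on_path t u v i'" "i' = Suc i \<or> i = Suc i'" "i' \<le> t"
    using Suc.prems(6,7) by (elim conjE disjE) (auto intro: that[of "Suc i"] that[of "i - 1"])
  have "\<phi> x' \<noteq> Branch w" for w
    using Suc.prems(2) x' by (auto simp: inner_blobs_def branch_blobs_def)
  with i' have i'': "\<phi> x' = Inner u v i'" "0 < i'" "i' < t"
    by (auto simp: on_path_def split: if_splits)
  obtain j where j: "\<phi> y = Inner u v j" "0 < j" "j < t" "j \<le> i' + m" "i' \<le> j + m"
    "\<And>l. i' \<le> l \<and> l \<le> j \<or> j \<le> l \<and> l \<le> i' \<Longrightarrow> Inner u v l \<in> \<phi> ` A"
    using Suc.IH[OF x'(2) Suc.prems(2) _ i''(1) Suc.prems(5) i''(2,3)] x' by auto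
  have "Inner u v l \<in> \<phi> ` A" if "i \<le> l \<and> l \<le> j \<or> j \<le> l \<and> l \<le> i" for l
  proof (cases "l = i")
    case True
    then show ?thesis using in_A by simp
  next
    case False
    then show ?thesis using j(6)[of l] i'(2) that by linarith
  qed
  then show ?case using j i'(2) by auto
qed

text \<open>The vertices of an inner blob that has a neighbour form an interval of a subdivided
  edge, so that the blob can only be left at the two ends of the interval.\<close>
lemma inner_blob_interval:
  assumes A: "A \<in> inner_blobs"
  obtains u v a b where "u < v" "0 < a" "a \<le> t" "b < t" "b \<le> a + 2 * r"
    "\<And>x y. x \<in> A \<Longrightarrow> y \<in> \<Union>P - A \<Longrightarrow> (x, y) \<in> Q \<Longrightarrow>
       \<phi> x = on_path t u v a \<and> \<phi> y = on_path t u v (a - 1) \<or>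
       \<phi> x = on_path t u v b \<and> \<phi> y = on_path t u v (Suc b)"
proof (cases "\<exists>x y. x \<in> A \<and> y \<in> \<Union>P - A \<and> (x, y) \<in> Q")
  case False
  \<comment> \<open>No edge leaves the blob, so the last claim is vacuous and any numbers that meet
    the inequalities will do.\<close>
  then show ?thesis using that[of 0 1 1 0] t_pos by (auto simp: Suc_le_eq)
next
  case True
  then obtain x0 y0 where x0: "x0 \<in> A" "(x0, y0) \<in> Q" by blast
  have AP: "A \<in> P" using A by (simp add: inner_blobs_def)
  have inner: "\<exists>u v i. \<phi> x = Inner u v i" if "x \<in> A" for x
    using A that by (cases "\<phi> x") (auto simp: inner_blobs_def branch_blobs_def)
  obtain u v i0 where i0: "\<phi> x0 = Inner u v i0" using inner[OF x0(1)] by blast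
  have uv: "u < v" "0 < i0" "i0 < t" using subdivision_Inner[of u v i0] x0(2) i0 by auto
  \<comment> \<open>The positions occupied by the blob on the one path that contains it;
    \<open>interval\<close> below shows that they are consecutive.\<close>
  define J where "J = {i. Inner u v i \<in> \<phi> ` A}"
  have J: "\<exists>i\<in>J. \<phi> x = Inner u v i \<and> 0 < i \<and> i < t" if x: "x \<in> A" for x
  proof -
    obtain m where m: "(x0, x) \<in> (Q \<inter> A \<times> A) ^^ m"
      using linked[OF AP x0(1) x] by auto
    obtain i where "\<phi> x = Inner u v i" "0 < i" "i < t"
      using walk_in_inner_blob[OF m A x0(1) i0 uv] by auto
    moreover from this x have "i \<in> J" by (auto simp: J_def intro: rev_image_eqI)
    ultimately show ?thesis by auto
  qed
  have J_bounds: "0 < i \<and> i < t" if i: "i \<in> J" for i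
  proof -
    from i obtain x where "x \<in> A" "\<phi> x = Inner u v i" by (force simp: J_def)
    with J[of x] show ?thesis by auto
  qed
  have interval: "l \<in> J \<and> j \<le> i + 2 * r" if "i \<in> J" "j \<in> J" "i \<le> l" "l \<le> j" for i j l
  proof -
    obtain x y where xy: "x \<in> A" "\<phi> x = Inner u v i" "y \<in> A" "\<phi> y = Inner u v j"
      using \<open>i \<in> J\<close> \<open>j \<in> J\<close> unfolding J_def by (auto elim!: imageE simp: eq_commute)
    obtain m where m: "m \<le> 2 * r" "(x, y) \<in> (Q \<inter> A \<times> A) ^^ m"
      using linked[OF AP xy(1) xy(3)] by blast
    from walk_in_inner_blob[OF m(2) A xy(1,2) uv(1)] J_bounds[OF \<open>i \<in> J\<close>] m(1) that xy(4)
    show ?thesis by (auto simp: J_def)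
  qed
  have finJ: "finite J" by (rule finite_subset[of _ "{..<t}"]) (use J_bounds in auto)
  have neJ: "J \<noteq> {}" using J[OF x0(1)] by auto
  note m = Min_in[OF finJ neJ] Max_in[OF finJ neJ]
  have le: "Min J \<le> Max J" using m finJ by (simp add: Max_ge)
  show ?thesis
  proof (rule that[of u v "Min J" "Max J"])
    show "u < v" by fact
    show "0 < Min J" using J_bounds m by blast
    show "Min J \<le> t" using J_bounds m less_imp_le by blast
    show "Max J < t" using J_bounds m by blast
    show "Max J \<le> Min J + 2 * r" using interval[OF m, of "Max J"] le by auto
    fix x y assume xy: "x \<in> A" "y \<in> \<Union>P - A" "(x, y) \<in> Q"
    obtain i where i: "i \<in> J" "\<phi> x = Inner u v i" "0 < i" "i < t" using J[OF xy(1)] by blast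
    have "(Inner u v i, \<phi> y) \<in> subdivision t all_edges" using xy i by simp
    then have y: "\<phi> y = on_path t u v (Suc i) \<or> \<phi> y = on_path t u v (i - 1)"
      by (auto dest!: subdivision_Inner)
    have not_J: "\<phi> y \<noteq> Inner u v l" if l: "l \<in> J" for l
    proof
      assume "\<phi> y = Inner u v l"
      then obtain z where "z \<in> A" "\<phi> z = \<phi> y" using l by (force simp: J_def)
      then show False using xy(2) AP inj_blobs[of A _ z y] by auto
    qed
    have phx: "\<phi> x = on_path t u v i" using i by (simp add: on_path_def)
    have min: "Min J \<le> i" "i \<le> Max J" using i finJ by auto
    show "\<phi> x = on_path t u v (Min J) \<and> \<phi> y = on_path t u v (Min J - 1) \<or>
       \<phi> x = on_path t u v (Max J) \<and> \<phi> y = on_path t u v (Suc (Max J))"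
    proof (cases "\<phi> y = on_path t u v (Suc i)")
      case True
      \<comment> \<open>An edge going up starts at the largest position, since otherwise the next
        position belongs to the blob as well.\<close>
      have "i = Max J"
      proof (rule ccontr)
        assume "i \<noteq> Max J"
        then have "Suc i \<in> J" using interval[OF m, of "Suc i"] min by auto
        with J_bounds[OF this] not_J[OF this] True show False by (auto simp: on_path_def)
      qed
      then show ?thesis using phx True by simp
    next
      case False
      then have y: "\<phi> y = on_path t u v (i - 1)" using y by simp
      have "i = Min J"
      proof (rule ccontr)
        assume "i \<noteq> Min J"
        then have "i - 1 \<in> J" using interval[OF m, of "i - 1"] min by auto
        with J_bounds[OF this] not_J[OF this] y show False by (auto simp: on_path_def)
      qed
      then show ?thesis using phx y by simp
    qed
  qed
qed

section \<open>Counting adjacent pairs of blobs\<close>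

lemma finite_nbrs: "finite (nbrs A)"
  using finite_blobs by (simp add: nbrs_def)

lemma nbr_unique:
  assumes "B \<in> P" "B' \<in> P" "y \<in> B" "y' \<in> B'" "\<phi> y = \<phi> y'"
  shows "B = B'"
proof -
  have "y = y'" using assms inj_blobs by blast
  then show ?thesis using assms disjoint_blobs by blast
qed

text \<open>A neighbour must contain one of the two vertices just beyond the ends of the interval,
  and disjoint blobs contain different ones.\<close>

lemma card_nbrs_inner:
  assumes A: "A \<in> inner_blobs"
  shows "card (nbrs A) \<le> 2"
proof -
  from A have AP: "A \<in> P" by (simp add: inner_blobs_def)
  obtain u v a b where ab: "\<And>x y. x \<in> A \<Longrightarrow> y \<in> \<Union>P - A \<Longrightarrow> (x, y) \<in> Q \<Longrightarrow>
       \<phi> x = on_path t u v a \<and> \<phi> y = on_path t u v (a - 1) \<or>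
       \<phi> x = on_path t u v b \<and> \<phi> y = on_path t u v (Suc b)"
    by (rule inner_blob_interval[OF A]) blast
  have "\<exists>y. y \<in> B \<and> \<phi> y \<in> {on_path t u v (a - 1), on_path t u v (Suc b)}" if "B \<in> nbrs A" for B
  proof -
    from that obtain x y where "B \<in> P" "B \<noteq> A" "x \<in> A" "y \<in> B" "(x, y) \<in> Q"
      unfolding nbrs_def by blast
    moreover from this have "y \<in> \<Union>P - A" using disjoint_blobs AP by auto
    ultimately show ?thesis using ab[of x y] by auto
  qed
  then have "\<forall>B\<in>nbrs A. \<exists>y. y \<in> B \<and> \<phi> y \<in> {on_path t u v (a - 1), on_path t u v (Suc b)}"
    by blast
  from bchoice[OF this] obtain f where f: "\<And>B. B \<in> nbrs A \<Longrightarrow> f B \<in> B \<and>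
      \<phi> (f B) \<in> {on_path t u v (a - 1), on_path t u v (Suc b)}" by blast
  have "inj_on (\<lambda>B. \<phi> (f B)) (nbrs A)"
  proof (rule inj_onI)
    fix B B' assume B: "B \<in> nbrs A" "B' \<in> nbrs A" "\<phi> (f B) = \<phi> (f B')"
    then have "B \<in> P" "B' \<in> P" by (auto simp: nbrs_def)
    then show "B = B'" using nbr_unique f B by blast
  qed
  then have "card (nbrs A) \<le> card {on_path t u v (a - 1), on_path t u v (Suc b)}"
    by (rule card_inj_on_le) (use f in auto)
  also have "\<dots> \<le> 2" by (simp add: card_insert_if)
  finally show ?thesis .
qed

text \<open>A branch blob beyond the lower end forces \<open>a \<le> 2 * r + 1\<close>, one beyond
  the upper end \<open>t - Suc b \<le> 2 * r\<close>. As \<open>b \<le> a + 2 * r\<close>, both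
  together would give \<open>t \<le> 6 * r + 2\<close>; so all branch neighbours lie at the same end
  and coincide.\<close>

lemma card_branch_nbrs_inner:
  assumes A: "A \<in> inner_blobs" and t: "6 * r + 2 < t"
  shows "card (nbrs A \<inter> branch_blobs) \<le> 1"
proof -
  from A have AP: "A \<in> P" by (simp add: inner_blobs_def)
  obtain u v a b where uv: "u < v" "0 < a" "a \<le> t" "b < t" "b \<le> a + 2 * r"
    and ab: "\<And>x y. x \<in> A \<Longrightarrow> y \<in> \<Union>P - A \<Longrightarrow> (x, y) \<in> Q \<Longrightarrow>
       \<phi> x = on_path t u v a \<and> \<phi> y = on_path t u v (a - 1) \<or>
       \<phi> x = on_path t u v b \<and> \<phi> y = on_path t u v (Suc b)"
    by (rule inner_blob_interval[OF A]) blast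
  have nbr: "\<exists>y\<in>B. \<phi> y = on_path t u v (a - 1) \<and> a \<le> 2 * r + 1 \<or>
      \<phi> y = on_path t u v (Suc b) \<and> t - Suc b \<le> 2 * r"
    if B: "B \<in> nbrs A" "B \<in> branch_blobs" for B
  proof -
    from B obtain x y where xy: "B \<in> P" "B \<noteq> A" "x \<in> A" "y \<in> B" "(x, y) \<in> Q"
      unfolding nbrs_def by blast
    have y: "y \<in> \<Union>P - A" using disjoint_blobs[OF xy(1) AP xy(4)] xy by auto
    note near = branch_blob_near_end[OF AP B(2) xy(2)[symmetric] xy(3,4) uv(1)]
    from ab[OF xy(3) y xy(5)] show ?thesis
    proof
      assume "\<phi> x = on_path t u v a \<and> \<phi> y = on_path t u v (a - 1)"
      moreover from this have "a - 1 \<le> 2 * r" using near[of "a - 1" a] uv by auto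
      then have "a \<le> 2 * r + 1" by linarith
      ultimately show ?thesis using xy(4) by blast
    next
      assume "\<phi> x = on_path t u v b \<and> \<phi> y = on_path t u v (Suc b)"
      then show ?thesis using near[of "Suc b" b] uv xy(4) by (intro bexI[of _ y]) auto
    qed
  qed
  have "B = B'" if B: "B \<in> nbrs A \<inter> branch_blobs" "B' \<in> nbrs A \<inter> branch_blobs" for B B'
  proof -
    have P: "B \<in> P" "B' \<in> P" using B by (auto simp: nbrs_def)
    obtain y y' where "y \<in> B" "y' \<in> B'"
      "\<phi> y = on_path t u v (a - 1) \<and> a \<le> 2 * r + 1 \<or>
        \<phi> y = on_path t u v (Suc b) \<and> t - Suc b \<le> 2 * r"
      "\<phi> y' = on_path t u v (a - 1) \<and> a \<le> 2 * r + 1 \<or>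
        \<phi> y' = on_path t u v (Suc b) \<and> t - Suc b \<le> 2 * r"
      using nbr[of B] nbr[of B'] B by blast
    moreover have "\<not> (a \<le> 2 * r + 1 \<and> t - Suc b \<le> 2 * r)" using t uv by linarith
    ultimately show ?thesis using nbr_unique[OF P, of y y'] by auto
  qed
  then show ?thesis
    using card_le_Suc0_iff_eq[of "nbrs A \<inter> branch_blobs"] finite_nbrs by auto
qed

lemma nbrs_sym: "A \<in> P \<Longrightarrow> B \<in> nbrs A \<Longrightarrow> A \<in> nbrs B"
  using sym_subdivision[of t all_edges] unfolding nbrs_def by (auto dest: symD)

lemma branch_sub: "branch_blobs \<subseteq> P" and inner_sub: "inner_blobs \<subseteq> P"
  and blobs_split: "P = inner_blobs \<union> branch_blobs" "inner_blobs \<inter> branch_blobs = {}"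
  by (auto simp: branch_blobs_def inner_blobs_def)

text \<open>A branch blob may have many inner neighbours. Adjacencies between the two kinds are
  therefore charged to the inner blob, where the number of neighbours is bounded.\<close>

lemma sum_card_nbrs:
  "(\<Sum>A\<in>P. card (nbrs A)) = (\<Sum>A\<in>inner_blobs. card (nbrs A) + card (nbrs A \<inter> branch_blobs))
     + (\<Sum>A\<in>branch_blobs. card (nbrs A \<inter> branch_blobs))"
proof -
  note fin = finite_subset[OF branch_sub finite_blobs] finite_subset[OF inner_sub finite_blobs]
  have sym: "B \<in> nbrs A \<longleftrightarrow> A \<in> nbrs B" if "A \<in> P" "B \<in> P" for A B
    using nbrs_sym that by blast
  have count: "card (nbrs A \<inter> C) = (\<Sum>B\<in>C. if B \<in> nbrs A then 1 else 0)" if "finite C" for A C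
    using that by (simp add: sum.If_cases Int_commute)
  have "(\<Sum>A\<in>branch_blobs. card (nbrs A \<inter> inner_blobs)) =
      (\<Sum>A\<in>branch_blobs. \<Sum>B\<in>inner_blobs. if B \<in> nbrs A then 1 else 0)"
    by (simp only: count[OF fin(2)])
  also have "\<dots> = (\<Sum>B\<in>inner_blobs. \<Sum>A\<in>branch_blobs. if B \<in> nbrs A then 1 else 0)"
    by (rule sum.swap)
  also have "\<dots> = (\<Sum>B\<in>inner_blobs. \<Sum>A\<in>branch_blobs. if A \<in> nbrs B then 1 else 0)"
    using sym branch_sub inner_sub by (intro sum.cong refl) auto
  also have "\<dots> = (\<Sum>B\<in>inner_blobs. card (nbrs B \<inter> branch_blobs))"
    by (simp only: count[OF fin(1)])
  finally have swap: "(\<Sum>A\<in>branch_blobs. card (nbrs A \<inter> inner_blobs)) =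
     (\<Sum>B\<in>inner_blobs. card (nbrs B \<inter> branch_blobs))" .
  have "card (nbrs A) = card (nbrs A \<inter> branch_blobs) + card (nbrs A \<inter> inner_blobs)" for A
  proof -
    have "nbrs A = nbrs A \<inter> branch_blobs \<union> nbrs A \<inter> inner_blobs"
      using blobs_split(1) by (auto simp: nbrs_def)
    then show ?thesis
      using card_Un_disjoint[of "nbrs A \<inter> branch_blobs" "nbrs A \<inter> inner_blobs"]
        finite_nbrs[of A] blobs_split(2) by auto
  qed
  then have "(\<Sum>A\<in>branch_blobs. card (nbrs A)) = (\<Sum>A\<in>branch_blobs. card (nbrs A \<inter> branch_blobs))
      + (\<Sum>B\<in>inner_blobs. card (nbrs B \<inter> branch_blobs))"
    by (simp add: sum.distrib swap)
  moreover have "(\<Sum>A\<in>P. card (nbrs A)) = (\<Sum>A\<in>inner_blobs. card (nbrs A)) +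
      (\<Sum>A\<in>branch_blobs. card (nbrs A))"
    using sum.union_disjoint[OF fin(2,1) blobs_split(2), of "\<lambda>A. card (nbrs A)"]
    by (simp flip: blobs_split(1))
  ultimately show ?thesis by (simp add: sum.distrib)
qed

lemma sum_card_nbrs_le:
  assumes branch: "\<And>A x u. A \<in> P \<Longrightarrow> x \<in> A \<Longrightarrow> \<phi> x = Branch u \<Longrightarrow> u < N"
  shows "(\<Sum>A\<in>P. card (nbrs A)) \<le> (N + 4) * card P"
proof -
  \<comment> \<open>A branch label chosen in each branch blob; distinct blobs get distinct labels,
    so there are at most \<open>N\<close> branch blobs.\<close>
  obtain f where f: "\<And>B. B \<in> branch_blobs \<Longrightarrow> \<exists>x\<in>B. \<phi> x = Branch (f B)"
    using bchoice[of branch_blobs "\<lambda>B u. \<exists>x\<in>B. \<phi> x = Branch u"]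
    unfolding branch_blobs_def by blast
  have "inj_on f branch_blobs"
  proof (rule inj_onI)
    fix B B' assume B: "B \<in> branch_blobs" "B' \<in> branch_blobs" "f B = f B'"
    obtain x x' where "x \<in> B" "\<phi> x = Branch (f B)" "x' \<in> B'" "\<phi> x' = Branch (f B')"
      using f B by blast
    then show "B = B'" using nbr_unique[of B B' x x'] B branch_sub by auto
  qed
  moreover have "f ` branch_blobs \<subseteq> {..<N}" using f branch branch_sub by blast
  ultimately have "card branch_blobs \<le> N"
    using card_inj_on_le[of f branch_blobs "{..<N}"] by simp
  moreover have "card (nbrs A \<inter> branch_blobs) \<le> card branch_blobs" for A
    using finite_subset[OF branch_sub finite_blobs] by (intro card_mono) auto
  ultimately have br: "card (nbrs A \<inter> branch_blobs) \<le> N" for A using le_trans by blast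
  have inn: "card (nbrs A) + card (nbrs A \<inter> branch_blobs) \<le> 4" if "A \<in> inner_blobs" for A
    using card_nbrs_inner[OF that] card_mono[OF finite_nbrs, of "nbrs A \<inter> branch_blobs" A] by auto
  have "(\<Sum>A\<in>P. card (nbrs A)) \<le> 4 * card inner_blobs + N * card branch_blobs"
    unfolding sum_card_nbrs
    using sum_bounded_above[of inner_blobs, OF inn] sum_bounded_above[of branch_blobs, OF br]
    by (simp add: mult.commute add_mono)
  also have "\<dots> \<le> 4 * card P + N * card P"
    using branch_sub inner_sub finite_blobs by (intro add_mono mult_left_mono card_mono) auto
  finally show ?thesis by (simp add: algebra_simps)
qed

text \<open>Each inner blob is charged at most 2 + 1, and each branch blob nothing, no two of them
  being adjacent.\<close>

lemma sum_card_nbrs_le_3: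
  assumes t: "6 * r + 2 < t"
  shows "(\<Sum>A\<in>P. card (nbrs A)) \<le> 3 * card P"
proof -
  have "card (nbrs A) + card (nbrs A \<inter> branch_blobs) \<le> 3" if "A \<in> inner_blobs" for A
    using card_nbrs_inner[OF that] card_branch_nbrs_inner[OF that t] by auto
  then have "(\<Sum>A\<in>inner_blobs. card (nbrs A) + card (nbrs A \<inter> branch_blobs)) \<le> card inner_blobs * 3"
    by (metis (no_types, lifting) sum_bounded_above of_nat_id)
  then have "(\<Sum>A\<in>P. card (nbrs A)) \<le> 3 * card inner_blobs"
    unfolding sum_card_nbrs using branch_blobs_independent t by simp
  also have "\<dots> \<le> 3 * card P"
    using inner_sub finite_blobs by (intro mult_left_mono card_mono) auto
  finally show ?thesis .
qed

end

subsection \<open>The class of subdivided graphs\<close>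

text \<open>The labels \<open>Inner u v i\<close> that lie on no subdivided edge serve as isolated vertices.\<close>
definition subdivided_class :: "(nat \<Rightarrow> nat) \<Rightarrow> nat ugraph set" where
  "subdivided_class \<tau> = {G. finite_simple_graph G \<and>
     (\<exists>N \<phi>. inj_on \<phi> (verts G) \<and> (\<forall>x\<in>verts G. \<forall>u. \<phi> x = Branch u \<longrightarrow> u < N) \<and>
        adj G \<subseteq> inv_image (subdivision (\<tau> N) all_edges) \<phi>)}"

section \<open>Distance and radius in terms of walks\<close>

lemma less_enat_Suc_iff: "x < enat (Suc n) \<longleftrightarrow> x \<le> enat n"
  by (cases x) auto

lemma gdist_le_iff: "gdist G x y \<le> enat n \<longleftrightarrow> (\<exists>m\<le>n. (x, y) \<in> adj G ^^ m)"
  by (auto simp: gdist_def INF_less_iff less_Suc_eq_le simp flip: less_enat_Suc_iff)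

lemma sym_adj: "sym (adj G)"
  by (auto simp: adj_def sym_def insert_commute)

text \<open>Both vertices are within \<open>r\<close> of a common centre \<open>c\<close>, which is
  extracted from the infimum by way of the strict bound \<open>enat (Suc r)\<close>.\<close>

lemma radius_walk:
  assumes "radius K \<le> enat r" "x \<in> verts K" "y \<in> verts K"
  shows "\<exists>m\<le>2 * r. (x, y) \<in> adj K ^^ m"
proof -
  have "radius K < enat (Suc r)" using assms(1) by (simp add: less_enat_Suc_iff)
  then obtain c where "c \<in> verts K" and c: "(SUP v\<in>verts K. gdist K c v) < enat (Suc r)"
    by (auto simp: radius_def INF_less_iff)
  have "gdist K c v \<le> enat r" if "v \<in> verts K" for v
  proof -
    have "gdist K c v < enat (Suc r)" by (rule le_less_trans[OF _ c]) (use that in \<open>auto intro: SUP_upper\<close>)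
    then show ?thesis by (simp add: less_enat_Suc_iff)
  qed
  with assms(2,3) obtain i j where ij: "i \<le> r" "j \<le> r" "(c, x) \<in> adj K ^^ i" "(c, y) \<in> adj K ^^ j"
    by (auto simp: gdist_le_iff) blast
  then have "(x, y) \<in> adj K ^^ (i + j)"
    using sym_relpow[OF sym_adj, of c x] by (auto simp: relpow_add)
  with ij show ?thesis by (intro exI[of _ "i + j"]) auto
qed

lemma adj_in_verts: "finite_simple_graph G \<Longrightarrow> (x, y) \<in> adj G \<Longrightarrow> x \<in> verts G \<and> y \<in> verts G \<and> x \<noteq> y"
  by (auto simp: adj_def finite_simple_graph_def)

section \<open>Closure of the class under subgraphs and isomorphism\<close>

lemma subdivided_class_subgraph:
  assumes "G \<in> subdivided_class \<tau>" "subgraph H G"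
  shows "H \<in> subdivided_class \<tau>"
proof -
  have H: "finite_simple_graph H" "verts H \<subseteq> verts G" "adj H \<subseteq> adj G"
    using assms(2) by (auto simp: subgraph_def adj_def)
  obtain N \<phi> where "inj_on \<phi> (verts G)" "\<forall>x\<in>verts G. \<forall>u. \<phi> x = Branch u \<longrightarrow> u < N"
      "adj G \<subseteq> inv_image (subdivision (\<tau> N) all_edges) \<phi>"
    using assms(1) by (auto simp: subdivided_class_def)
  with H show ?thesis
    unfolding subdivided_class_def
    by (intro CollectI conjI exI[of _ N] exI[of _ \<phi>]) (blast intro: inj_on_subset)+
qed

lemma subdivided_class_isomorphic:
  assumes "G \<in> subdivided_class \<tau>" "finite_simple_graph H" "isomorphic G H"
  shows "H \<in> subdivided_class \<tau>"
proof -
  obtain f where f: "bij_betw f (verts G) (verts H)" "edges H = (\<lambda>e. f ` e) ` edges G"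
    using assms(3) by (auto simp: isomorphic_def)
  obtain N \<phi> where G: "finite_simple_graph G" and \<phi>: "inj_on \<phi> (verts G)"
      "\<And>x u. x \<in> verts G \<Longrightarrow> \<phi> x = Branch u \<Longrightarrow> u < N"
      "adj G \<subseteq> inv_image (subdivision (\<tau> N) all_edges) \<phi>"
    using assms(1) by (auto simp: subdivided_class_def)
  define g where "g = inv_into (verts G) f"
  have g: "bij_betw g (verts H) (verts G)" unfolding g_def by (rule bij_betw_inv_into[OF f(1)])
  have gf: "g (f x) = x" if "x \<in> verts G" for x
    unfolding g_def using f(1) that by (simp add: bij_betw_inv_into_left)
  have "(g x, g y) \<in> adj G" if xy: "(x, y) \<in> adj H" for x y
  proof -
    obtain e where e: "e \<in> edges G" "{x, y} = f ` e" using xy f(2) by (auto simp: adj_def)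
    have "e \<subseteq> verts G" using G e by (auto simp: finite_simple_graph_def)
    then have "g ` f ` e = e" using gf by (force simp: image_image)
    then have "{g x, g y} = e" using e(2) by (metis image_empty image_insert)
    then show ?thesis using e(1) by (simp add: adj_def)
  qed
  moreover have "inj_on (\<phi> \<circ> g) (verts H)"
    using g \<phi>(1) by (auto simp: bij_betw_def intro: comp_inj_on)
  moreover have "g x \<in> verts G" if "x \<in> verts H" for x using g that by (auto simp: bij_betw_def)
  then have "\<forall>x\<in>verts H. \<forall>u. (\<phi> \<circ> g) x = Branch u \<longrightarrow> u < N" using \<phi>(2) by auto
  ultimately show ?thesis
    using \<phi>(3) assms(2) unfolding subdivided_class_def
    by (intro CollectI conjI exI[of _ N] exI[of _ "\<phi> \<circ> g"]) force+
qed

lemma finite_simple_graph_subdivided_class: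
  "G \<in> subdivided_class \<tau> \<Longrightarrow> finite_simple_graph G"
  by (simp add: subdivided_class_def)

lemma monotone_subdivided_class: "monotone_class (subdivided_class \<tau>)"
  unfolding monotone_class_def graph_class_def
  using subdivided_class_subgraph subdivided_class_isomorphic finite_simple_graph_subdivided_class
  by blast

lemma average_degree_depth_minor:
  assumes G: "G \<in> subdivided_class \<tau>" and \<tau>: "\<And>N. 0 < \<tau> N" and H: "depth_minor r G H"
  shows "\<exists>N. average_degree H \<le> real N + 4 \<and> (6 * r + 2 < \<tau> N \<longrightarrow> average_degree H \<le> 3)"
proof -
  obtain G' S where sub: "subgraph G' G"
    and S: "\<And>K. K \<in> S \<Longrightarrow> subgraph K G' \<and> connected_graph K \<and> radius K \<le> enat r"
    and disj: "pairwise (\<lambda>K L. disjnt (verts K) (verts L)) S"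
    and H: "H = contract G' S"
    using H unfolding depth_minor_def by blast
  obtain N \<phi> where G': "finite_simple_graph G'" and \<phi>: "inj_on \<phi> (verts G')"
      "\<And>x u. x \<in> verts G' \<Longrightarrow> \<phi> x = Branch u \<Longrightarrow> u < N"
      "adj G' \<subseteq> inv_image (subdivision (\<tau> N) all_edges) \<phi>"
    using subdivided_class_subgraph[OF G sub] by (auto simp: subdivided_class_def)
  define P where "P = verts ` S \<union> (\<lambda>v. {v}) ` (verts G' - (\<Union>K\<in>S. verts K))"
  have P: "A \<in> P \<Longrightarrow> A \<subseteq> verts G'" for A
    using S by (auto simp: P_def subgraph_def)
  interpret blob_family "\<tau> N" r \<phi> P
  proof
    show "0 < \<tau> N" by (rule \<tau>)
    have "P \<subseteq> Pow (verts G')" using P by auto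
    then show "finite P" using G' by (auto simp: finite_simple_graph_def intro: finite_subset)
    show "inj_on \<phi> (\<Union>P)" by (rule inj_on_subset[OF \<phi>(1)]) (use P in auto)
    show "A = B" if "A \<in> P" "B \<in> P" "x \<in> A" "x \<in> B" for A B x
      using that disj unfolding P_def pairwise_def disjnt_def by fast
    show "\<exists>m\<le>2 * r. (x, y) \<in> (inv_image (subdivision (\<tau> N) all_edges) \<phi> \<inter> A \<times> A) ^^ m"
      if A: "A \<in> P" "x \<in> A" "y \<in> A" for A x y
    proof (cases "A \<in> verts ` S")
      case True
      then obtain K where K: "K \<in> S" "A = verts K" by auto
      \<comment> \<open>The walk given by the radius stays in the contracted piece, and its steps
        are steps of the subdivision.\<close>
      have "adj K \<subseteq> adj G' \<inter> A \<times> A"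
        using S[OF K(1)] adj_in_verts[of K] K(2) by (auto simp: subgraph_def adj_def)
      then have K': "adj K \<subseteq> inv_image (subdivision (\<tau> N) all_edges) \<phi> \<inter> A \<times> A"
        using \<phi>(3) by blast
      obtain m where m: "m \<le> 2 * r" "(x, y) \<in> adj K ^^ m"
        using radius_walk[of K r x y] S[OF K(1)] A K(2) by auto
      show ?thesis using m(1) relpow_mono[OF K' m(2)] by (intro exI[of _ m] conjI)
    next
      case False
      then have "x = y" using A by (auto simp: P_def)
      then show ?thesis by (intro exI[of _ 0]) auto
    qed
  qed
  have verts_H: "verts H = P" by (simp add: H contract_def P_def Let_def)
  have edges_H: "edges H = {{A, B} |A B. A \<in> P \<and> B \<in> P \<and> A \<noteq> B \<and>
                             (\<exists>a\<in>A. \<exists>b\<in>B. {a, b} \<in> edges G')}"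
    by (simp add: H contract_def P_def Let_def)
  \<comment> \<open>An edge of \<open>H\<close> at \<open>A\<close> is determined by its other end,
    which is a neighbour of \<open>A\<close>.\<close>
  have "degree H A \<le> card (nbrs A)" if "A \<in> P" for A
  proof -
    have nbr: "B \<in> nbrs A" if "B \<in> P" "A \<noteq> B" "a \<in> A" "b \<in> B" "{a, b} \<in> edges G'" for B a b
      using that \<phi>(3) by (auto simp: nbrs_def adj_def)
    have "{e \<in> edges H. A \<in> e} \<subseteq> (\<lambda>B. {A, B}) ` nbrs A"
    proof
      fix e assume "e \<in> {e \<in> edges H. A \<in> e}"
      then obtain B C a b where "e = {B, C}" "A = B \<or> A = C" "B \<in> P" "C \<in> P" "B \<noteq> C" "a \<in> B" "b \<in> C"
        "{a, b} \<in> edges G'" unfolding edges_H by blast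
      then have "\<exists>D a b. e = {A, D} \<and> D \<in> P \<and> A \<noteq> D \<and> a \<in> A \<and> b \<in> D \<and> {a, b} \<in> edges G'"
        by (metis insert_commute)
      then show "e \<in> (\<lambda>B. {A, B}) ` nbrs A" using nbr by blast
    qed
    then have "degree H A \<le> card ((\<lambda>B. {A, B}) ` nbrs A)"
      unfolding degree_def by (intro card_mono finite_imageI finite_nbrs)
    also have "\<dots> \<le> card (nbrs A)" by (rule card_image_le[OF finite_nbrs])
    finally show ?thesis .
  qed
  then have le: "(\<Sum>A\<in>P. degree H A) \<le> (\<Sum>A\<in>P. card (nbrs A))" by (rule sum_mono)
  have avg: "average_degree H \<le> real c" if "(\<Sum>A\<in>P. card (nbrs A)) \<le> c * card P" for c
  proof -
    have "(\<Sum>A\<in>P. degree H A) \<le> c * card P" using le that by linarith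
    then have "(\<Sum>A\<in>P. real (degree H A)) \<le> real c * real (card P)"
      by (metis of_nat_le_iff of_nat_mult of_nat_sum)
    \<comment> \<open>For an empty minor the quotient by 0 is 0.\<close>
    then show ?thesis
      by (cases "card P = 0") (auto simp: average_degree_def verts_H divide_le_eq)
  qed
  have "average_degree H \<le> real (N + 4)"
    by (rule avg, rule sum_card_nbrs_le) (use P \<phi>(2) in blast)
  moreover have "average_degree H \<le> real 3" if "6 * r + 2 < \<tau> N"
    by (rule avg, rule sum_card_nbrs_le_3[OF that])
  ultimately show ?thesis by (intro exI[of _ N]) auto
qed

text \<open>The third assumption makes \<tau> grow at least like an inverse of \<open>f\<close>:
  once the depth is comparable to the path length \<open>\<tau> N\<close>, the bound
  \<open>f r\<close> already allows degree about \<open>N\<close>.\<close>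

lemma expansion_subdivided_class:
  assumes "\<And>N. 0 < \<tau> N" "\<And>r. 3 \<le> f r" "\<And>N r. \<tau> N \<le> 6 * r + 2 \<Longrightarrow> real N + 4 \<le> f r"
  shows "expansion_at_most (subdivided_class \<tau>) f"
  unfolding expansion_at_most_def
proof (intro allI impI ballI)
  fix r G H assume "G \<in> subdivided_class \<tau>" "depth_minor r G H"
  then obtain N where N: "average_degree H \<le> real N + 4"
    "6 * r + 2 < \<tau> N \<longrightarrow> average_degree H \<le> 3"
    using average_degree_depth_minor assms(1) by metis
  then show "average_degree H \<le> f r"
    using assms(2)[of r] assms(3)[of N r] by (cases "6 * r + 2 < \<tau> N") auto
qed

subsection \<open>Dense graphs without short cycles\<close>

text \<open>The last clause says that there is no cycle of length at most \<open>k + 1\<close>.\<close>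
definition sparse :: "nat \<Rightarrow> nat \<Rightarrow> 'a rel \<Rightarrow> bool" where
  "sparse k D R \<longleftrightarrow> sym R \<and> irrefl R \<and> (\<forall>x. card (R `` {x}) \<le> D) \<and>
     (\<forall>(x, y)\<in>R. \<forall>m\<le>k. (x, y) \<notin> (R - {(x, y), (y, x)}) ^^ m)"

text \<open>Keep the part of the walk before the first use of the new edge and the part after the
  last. If both uses have the same direction, one crossing joins the parts; otherwise the parts
  meet, and a shorter walk avoids the edge.\<close>

lemma walk_insert_edge:
  fixes R :: "'a rel"
  assumes "(x, y) \<in> (R \<union> {(u, v), (v, u)}) ^^ n"
  shows "(x, y) \<in> R ^^ n \<or> (\<exists>m<n. (x, y) \<in> R ^^ m) \<or>
    (\<exists>i j. i + j < n \<and> ((x, u) \<in> R ^^ i \<and> (v, y) \<in> R ^^ j \<or> (x, v) \<in> R ^^ i \<and> (u, y) \<in> R ^^ j))"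
  using assms
proof (induction n arbitrary: y)
  case 0
  then show ?case by simp
next
  case (Suc n)
  then obtain z where z: "(x, z) \<in> (R \<union> {(u, v), (v, u)}) ^^ n" "(z, y) \<in> R \<union> {(u, v), (v, u)}"
    by auto
  consider (R) m where "m \<le> n" "(x, z) \<in> R ^^ m" |
    (uv) i j where "i + j < n" "(x, u) \<in> R ^^ i" "(v, z) \<in> R ^^ j" |
    (vu) i j where "i + j < n" "(x, v) \<in> R ^^ i" "(u, z) \<in> R ^^ j"
    using Suc.IH[OF z(1)] by (metis less_imp_le order_refl)
  then show ?case
  proof cases
    case R
    show ?thesis
    proof (cases "(z, y) \<in> R")
      case True
      then have "(x, y) \<in> R ^^ Suc m" using R by auto
      then show ?thesis using R(1) by (metis le_neq_implies_less Suc_less_eq)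
    next
      case False
      then have "z = u \<and> y = v \<or> z = v \<and> y = u" using z(2) by auto
      then show ?thesis using R by (metis add_0_right le_imp_less_Suc relpow_0_I)
    qed
  next
    case uv
    show ?thesis
    proof (cases "(z, y) \<in> R")
      case True
      then have "(v, y) \<in> R ^^ Suc j" using uv by auto
      then show ?thesis using uv by (metis add_Suc_right Suc_less_eq)
    next
      case False
      then have "y = v \<or> y = u" using z(2) by auto
      moreover have "i < Suc n" "i + 0 < Suc n" using uv(1) by auto
      ultimately show ?thesis using uv(2) relpow_0_I[of v R] by metis
    qed
  next
    case vu
    show ?thesis
    proof (cases "(z, y) \<in> R")
      case True
      then have "(u, y) \<in> R ^^ Suc j" using vu by auto
      then show ?thesis using vu by (metis add_Suc_right Suc_less_eq)
    next
      case False
      then have "y = v \<or> y = u" using z(2) by auto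
      moreover have "i < Suc n" "i + 0 < Suc n" using vu(1) by auto
      ultimately show ?thesis using vu(2) relpow_0_I[of u R] by metis
    qed
  qed
qed

text \<open>A ball grows by a factor of at most \<open>D + 1\<close> per unit of radius: each vertex
  contributes itself and at most \<open>D\<close> successors.\<close>

lemma card_ball_le:
  fixes R :: "'a rel"
  assumes "finite R" "\<And>x. card (R `` {x}) \<le> D"
  shows "finite {y. \<exists>m\<le>k. (x, y) \<in> R ^^ m} \<and> card {y. \<exists>m\<le>k. (x, y) \<in> R ^^ m} \<le> (D + 1) ^ k"
proof (induction k)
  case 0
  have "{y. \<exists>m\<le>0. (x, y) \<in> R ^^ m} = {x}" by auto
  then show ?case by simp
next
  case (Suc k)
  define B where "B = {y. \<exists>m\<le>k. (x, y) \<in> R ^^ m}"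
  have B: "finite B" "card B \<le> (D + 1) ^ k" using Suc by (auto simp: B_def)
  have eq: "{y. \<exists>m\<le>Suc k. (x, y) \<in> R ^^ m} = (\<Union>z\<in>B. insert z (R `` {z}))" (is "?L = ?R")
  proof
    show "?L \<subseteq> ?R"
    proof
      fix y assume "y \<in> ?L"
      then obtain m where m: "m \<le> Suc k" "(x, y) \<in> R ^^ m" by blast
      show "y \<in> ?R"
      proof (cases m)
        case 0
        then show ?thesis using m by (auto simp: B_def intro!: exI[of _ x] exI[of _ 0])
      next
        case (Suc m')
        then show ?thesis using m by (auto simp: B_def)
      qed
    qed
    show "?R \<subseteq> ?L"
    proof
      fix y assume "y \<in> ?R"
      then obtain z m where zm: "m \<le> k" "(x, z) \<in> R ^^ m" "y = z \<or> (z, y) \<in> R" by (auto simp: B_def)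
      then have "(x, y) \<in> R ^^ m \<or> (x, y) \<in> R ^^ Suc m" by auto
      moreover have "m \<le> Suc k" "Suc m \<le> Suc k" using zm(1) by auto
      ultimately show "y \<in> ?L" by blast
    qed
  qed
  have fin: "finite (R `` {z})" for z using assms(1) by (simp add: finite_Image)
  have "card ?R \<le> (\<Sum>z\<in>B. card (insert z (R `` {z})))" by (rule card_UN_le[OF B(1)])
  also have "\<dots> \<le> (\<Sum>z\<in>B. D + 1)"
    using assms(2) by (intro sum_mono) (simp add: card_insert_if fin le_SucI)
  also have "\<dots> \<le> (D + 1) ^ k * (D + 1)" using B(2) by (simp only: sum_constant of_nat_id mult_le_mono1)
  also have "\<dots> = (D + 1) ^ Suc k" by simp
  finally show ?case using B(1) fin by (simp add: eq)
qed

text \<open>A sparse relation with the largest number of edges works: two vertices of degree less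
  than \<open>D\<close> are at distance at most \<open>k\<close>, as they could be joined otherwise.\<close>
lemma exists_dense_sparse:
  assumes k: "1 \<le> k" and N: "2 * (D + 1) ^ k \<le> N"
  obtains R where "R \<subseteq> {..<N} \<times> {..<N}" "sparse k D R" "D * N \<le> 2 * card R"
proof -
  define \<R> where "\<R> = {R. R \<subseteq> {..<N} \<times> {..<N} \<and> sparse k D R}"
  have "finite \<R>" by (rule finite_subset[of _ "Pow ({..<N} \<times> {..<N})"]) (auto simp: \<R>_def)
  moreover have "{} \<in> \<R>" by (auto simp: \<R>_def sparse_def sym_def irrefl_def)
  ultimately have "Max (card ` \<R>) \<in> card ` \<R>" by (intro Max_in) auto
  then obtain R where R\<R>: "R \<in> \<R>" and max: "card R = Max (card ` \<R>)" by auto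
  have max: "card S \<le> card R" if "S \<in> \<R>" for S
    using that \<open>finite \<R>\<close> by (simp add: max)
  have RN: "R \<subseteq> {..<N} \<times> {..<N}" and sp: "sparse k D R" using R\<R> by (auto simp: \<R>_def)
  then have symR: "sym R" and irr: "irrefl R" and deg: "\<And>x. card (R `` {x}) \<le> D"
    and girth: "\<And>x y m. (x, y) \<in> R \<Longrightarrow> m \<le> k \<Longrightarrow> (x, y) \<notin> (R - {(x, y), (y, x)}) ^^ m"
    by (auto simp: sparse_def)
  have finR: "finite R" using RN by (rule finite_subset) simp
  define L where "L = {x. x < N \<and> card (R `` {x}) < D}"
  have "L \<subseteq> {..<N}" by (auto simp: L_def)
  \<comment> \<open>Maximality enters here: otherwise the edge between \<open>u\<close> and
    \<open>v\<close> could be added in both directions, since both degrees are below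
    \<open>D\<close> and no short cycle arises.\<close>
  have close: "\<exists>m\<le>k. (u, v) \<in> R ^^ m" if uv: "u \<in> L" "v \<in> L" for u v
  proof (rule ccontr)
    assume far: "\<not> ?thesis"
    define S where "S = R \<union> {(u, v), (v, u)}"
    have ne: "u \<noteq> v" using far by auto
    have far': "(v, u) \<notin> R ^^ m" if "m \<le> k" for m
      using far that sym_relpow[OF symR] by blast
    have "card (S `` {x}) \<le> D" for x
    proof -
      have "S `` {x} = R `` {x} \<union> (if x = u then {v} else if x = v then {u} else {})"
        using ne by (auto simp: S_def)
      then have "card (S `` {x}) \<le> card (R `` {x}) + (if x = u \<or> x = v then 1 else 0)"
        using card_Un_le[of "R `` {x}" "if x = u then {v} else if x = v then {u} else {}"]
        by (auto split: if_splits)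
      then show ?thesis using deg[of x] uv by (auto simp: L_def split: if_splits)
    qed
    moreover have "sym S" using symR by (auto simp: S_def sym_def)
    moreover have "irrefl S" using irr ne by (auto simp: S_def irrefl_def)
    moreover have "(x, y) \<notin> (S - {(x, y), (y, x)}) ^^ m" if xy: "(x, y) \<in> S" "m \<le> k" for x y m
    proof (cases "(x, y) \<in> R")
      \<comment> \<open>The edge in question is the new one; the rest lies in \<open>R\<close>,
        where \<open>u\<close> and \<open>v\<close> are far apart.\<close>
      case False
      then have "S - {(x, y), (y, x)} \<subseteq> R" "x = u \<and> y = v \<or> x = v \<and> y = u"
        using xy symR by (auto simp: S_def)
      then show ?thesis using far far' xy(2) relpow_mono by metis
    next
      \<comment> \<open>If a short walk through the new edge closes a cycle with the old edge from
        \<open>x\<close> to \<open>y\<close>, the rest of that cycle joins \<open>u\<close> and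
        \<open>v\<close> within \<open>R\<close> in \<open>i + j + 1 \<le> k\<close> steps.\<close>
      case True
      define R' where "R' = R - {(x, y), (y, x)}"
      show ?thesis
      proof
        assume "(x, y) \<in> (S - {(x, y), (y, x)}) ^^ m"
        then have "(x, y) \<in> (R' \<union> {(u, v), (v, u)}) ^^ m"
          by (rule relpow_mono[rotated]) (auto simp: S_def R'_def)
        from walk_insert_edge[OF this]
        consider n where "n \<le> m" "(x, y) \<in> R' ^^ n" |
          i j where "i + j < m" "(x, u) \<in> R' ^^ i" "(v, y) \<in> R' ^^ j" |
          i j where "i + j < m" "(x, v) \<in> R' ^^ i" "(u, y) \<in> R' ^^ j"
          by (metis less_imp_le order_refl)
        then show False
        proof cases
          case 1
          then show ?thesis using girth[OF True, of n] xy(2) by (simp add: R'_def)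
        next
          case 2
          have "R' \<subseteq> R" by (auto simp: R'_def)
          note w = relpow_mono[OF this 2(2)] relpow_mono[OF this 2(3)]
          have "(v, x) \<in> R ^^ Suc j" using w(2) True symR by (auto dest: symD)
          then have "(v, u) \<in> R ^^ (Suc j + i)" using w(1) unfolding relpow_add by blast
          then show ?thesis using far'[of "Suc j + i"] 2(1) xy(2) by auto
        next
          case 3
          have "R' \<subseteq> R" by (auto simp: R'_def)
          note w = relpow_mono[OF this 3(2)] relpow_mono[OF this 3(3)]
          have "(u, x) \<in> R ^^ Suc j" using w(2) True symR by (auto dest: symD)
          moreover have "Suc j + i \<le> k" using 3(1) xy(2) by linarith
          ultimately have "\<exists>m\<le>k. (u, v) \<in> R ^^ m" using w(1) relpow_add[of "Suc j" i R] by blast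
          then show ?thesis using far by blast
        qed
      qed
    qed
    ultimately have "sparse k D S" unfolding sparse_def by blast
    moreover have "S \<subseteq> {..<N} \<times> {..<N}" using RN uv by (auto simp: S_def L_def)
    ultimately have "S \<in> \<R>" by (simp add: \<R>_def)
    moreover have "(u, v) \<notin> R"
      using far k relpow_1 by auto
    then have "card R < card S" unfolding S_def by (intro psubset_card_mono) (use finR in auto)
    ultimately show False using max by fastforce
  qed
  \<comment> \<open>The vertices of low degree lie in one ball of radius \<open>k\<close>, hence are
    at most half of all; the others have degree at least \<open>D\<close>.\<close>
  have "card L \<le> (D + 1) ^ k"
  proof (cases "L = {}")
    case False
    then obtain u where "u \<in> L" by blast
    then have "L \<subseteq> {y. \<exists>m\<le>k. (u, y) \<in> R ^^ m}" using close by auto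
    then show ?thesis
      using card_ball_le[OF finR deg, of k u] card_mono le_trans by blast
  qed auto
  then have L: "2 * card L \<le> N" using N by linarith
  have "R = Sigma {..<N} (\<lambda>x. R `` {x})" using RN by auto
  then have "card R = card (Sigma {..<N} (\<lambda>x. R `` {x}))" by metis
  also have "\<dots> = (\<Sum>x<N. card (R `` {x}))"
    using finR by (intro card_SigmaI) (auto simp: finite_Image)
  also have "\<dots> \<ge> (\<Sum>x\<in>{..<N} - L. card (R `` {x}))" by (intro sum_mono2) auto
  finally have "(\<Sum>x\<in>{..<N} - L. card (R `` {x})) \<le> card R" .
  moreover have "(\<Sum>x\<in>{..<N} - L. D) \<le> (\<Sum>x\<in>{..<N} - L. card (R `` {x}))"
    by (intro sum_mono) (auto simp: L_def)
  ultimately have "(N - card L) * D \<le> card R"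
    using card_Diff_subset[of L "{..<N}"] by (simp add: \<open>L \<subseteq> {..<N}\<close> finite_subset[OF \<open>L \<subseteq> {..<N}\<close>])
  moreover have "N * D \<le> (2 * (N - card L)) * D"
    by (intro mult_right_mono) (use L in auto)
  ultimately have "D * N \<le> 2 * card R" by (simp add: algebra_simps)
  with RN sp show ?thesis by (rule that)
qed

subsection \<open>Counting\<close>

lemma sum_Pow_power_card:
  fixes c :: "'b::comm_semiring_1"
  assumes "finite E"
  shows "(\<Sum>Z\<in>Pow E. c ^ card Z) = (1 + c) ^ card E"
  using prod_add[OF assms, of "\<lambda>_. c" "\<lambda>_. 1"] by (simp add: add.commute)

text \<open>Give the pair of \<open>Y\<close> and \<open>l\<close> the weight \<open>(1/2)\<^sup>d\<close>, where \<open>d\<close> is the distance of \<open>Y\<close> and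
  \<open>dec l\<close>: the weights sum to \<open>(3/2)\<^sup>m\<close> for each \<open>l\<close>, and to at least \<open>(1/2)\<^bsup>m/3\<^esup>\<close> for each \<open>Y\<close>.\<close>
lemma covering_bound:
  fixes dec :: "'l \<Rightarrow> 'e set"
  assumes E: "finite E" and L: "finite L" and dec: "\<And>l. l \<in> L \<Longrightarrow> dec l \<subseteq> E"
    and cover: "\<And>Y. Y \<subseteq> E \<Longrightarrow> \<exists>l\<in>L. 3 * card (sym_diff Y (dec l)) \<le> card E"
  shows "32 ^ card E \<le> card L ^ 3 * 27 ^ card E"
proof -
  define m where "m = card E"
  define w :: real where "w = (1/2) powr (m / 3)"
  have w3: "w ^ 3 = (1/2) ^ m"
    by (simp add: w_def powr_realpow[symmetric] powr_powr flip: powr_numeral)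
  have "(\<Sum>Y\<in>Pow E. \<Sum>l\<in>L. (1/2::real) ^ card (sym_diff Y (dec l))) =
     (\<Sum>l\<in>L. \<Sum>Y\<in>Pow E. (1/2) ^ card (sym_diff Y (dec l)))"
    by (rule sum.swap)
  \<comment> \<open>The symmetric difference with \<open>dec l\<close> is an involution on the
    subsets of \<open>E\<close>.\<close>
  also have "\<dots> = (\<Sum>l\<in>L. \<Sum>Z\<in>Pow E. (1/2) ^ card Z)"
  proof (rule sum.cong[OF refl])
    fix l assume "l \<in> L"
    from dec[OF this]
    show "(\<Sum>Y\<in>Pow E. (1/2::real) ^ card (sym_diff Y (dec l))) = (\<Sum>Z\<in>Pow E. (1/2) ^ card Z)"
      by (intro sum.reindex_bij_witness[of _ "\<lambda>Y. sym_diff Y (dec l)" "\<lambda>Y. sym_diff Y (dec l)"]) auto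
  qed
  also have "\<dots> = card L * (3/2) ^ m"
    by (simp add: sum_Pow_power_card[OF E] m_def)
  finally have total: "(\<Sum>Y\<in>Pow E. \<Sum>l\<in>L. (1/2::real) ^ card (sym_diff Y (dec l))) = card L * (3/2) ^ m" .
  have "w \<le> (\<Sum>l\<in>L. (1/2::real) ^ card (sym_diff Y (dec l)))" if "Y \<in> Pow E" for Y
  proof -
    obtain l where l: "l \<in> L" "3 * card (sym_diff Y (dec l)) \<le> m"
      using cover[of Y] \<open>Y \<in> Pow E\<close> by (auto simp: m_def)
    have "w \<le> (1/2) powr real (card (sym_diff Y (dec l)))"
      unfolding w_def by (rule powr_mono') (use l in auto)
    also have "\<dots> = (1/2) ^ card (sym_diff Y (dec l))" by (simp add: powr_realpow)
    also have "\<dots> \<le> (\<Sum>l\<in>L. (1/2::real) ^ card (sym_diff Y (dec l)))"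
      by (rule member_le_sum[OF l(1) _ L]) auto
    finally show ?thesis .
  qed
  then have "(\<Sum>Y\<in>Pow E. w) \<le> card L * (3/2) ^ m"
    unfolding total[symmetric] by (rule sum_mono)
  then have "2 ^ m * w \<le> card L * (3/2) ^ m" using E by (simp add: card_Pow m_def)
  \<comment> \<open>Cubing removes the exponent \<open>m / 3\<close>.\<close>
  then have "(2 ^ m * w) ^ 3 \<le> (card L * (3/2) ^ m) ^ 3"
    by (rule power_mono) (simp add: w_def)
  then have "8 ^ m * (1/2) ^ m \<le> real (card L) ^ 3 * (27/8) ^ m"
    by (simp add: power_mult_distrib w3 flip: power_mult)
       (simp add: mult.commute[of m 3] power_mult power_divide)
  moreover have "(8 :: real) ^ m * 8 ^ m = 2 ^ m * 32 ^ m" by (simp flip: power_mult_distrib)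
  ultimately have "real (32 ^ m) \<le> real (card L ^ 3 * 27 ^ m)"
    by (simp add: power_divide field_simps)
  then show ?thesis by (simp only: of_nat_le_iff m_def)
qed

text \<open>The constant 13 is the least exponent with
  \<open>8 * 27 ^ 13 \<le> 32 ^ 13\<close>.\<close>

lemma covering_bound_bits:
  assumes "32 ^ m \<le> (2 ^ q) ^ 3 * (27 :: nat) ^ m"
  shows "m \<le> 13 * q"
proof (rule ccontr)
  assume "\<not> ?thesis"
  then obtain j where m: "m = 13 * q + Suc j" by (metis less_imp_Suc_add not_le add_Suc_right)
  have "(2 ^ q) ^ 3 = (8 :: nat) ^ q" by (simp add: power_mult[symmetric] mult.commute[of q] power_mult[of _ 3])
  then have "(2 ^ q) ^ 3 * (27 :: nat) ^ m = (8 * 27 ^ 13) ^ q * 27 ^ Suc j"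
    by (simp only: m power_add power_mult power_mult_distrib mult.assoc)
  also have "\<dots> < (8 * 27 ^ 13) ^ q * 32 ^ Suc j"
    by (intro mult_strict_left_mono power_strict_mono) auto
  also have "\<dots> \<le> (32 ^ 13) ^ q * 32 ^ Suc j"
    by (intro mult_right_mono power_mono) auto
  also have "\<dots> = 32 ^ m" by (simp add: m power_add power_mult)
  finally show False using assms by simp
qed

text \<open>The expected number of bad \<open>e\<close> is at most \<open>c * card E\<close>, and
  some outcome does not exceed the expectation, which is a finite sum because the support is
  finite.\<close>

lemma pmf_few_failures:
  fixes p :: "'a pmf" and c :: real
  assumes fin: "finite (set_pmf p)" "finite E"
    and prob: "\<And>e. e \<in> E \<Longrightarrow> measure_pmf.prob p {x. bad e x} \<le> c"
  shows "\<exists>x\<in>set_pmf p. real (card {e \<in> E. bad e x}) \<le> c * card E"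
proof (rule ccontr)
  assume "\<not> ?thesis"
  then have less: "c * card E < card {e \<in> E. bad e x}" if "x \<in> set_pmf p" for x using that by force
  have one: "(\<Sum>x\<in>set_pmf p. pmf p x) = 1" by (rule sum_pmf_eq_1) (use fin in auto)
  have "c * card E = (\<Sum>x\<in>set_pmf p. c * card E * pmf p x)"
    by (simp add: one flip: sum_distrib_left)
  also have "\<dots> < (\<Sum>x\<in>set_pmf p. card {e \<in> E. bad e x} * pmf p x)"
    using fin less by (intro sum_strict_mono mult_strict_right_mono) (auto simp: set_pmf_not_empty pmf_positive)
  also have "\<dots> = (\<Sum>x\<in>set_pmf p. \<Sum>e\<in>E. if bad e x then pmf p x else 0)"
    using fin by (intro sum.cong refl) (simp add: sum.If_cases Int_def)
  also have "\<dots> = (\<Sum>e\<in>E. \<Sum>x\<in>set_pmf p. if bad e x then pmf p x else 0)"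
    by (rule sum.swap)
  also have "\<dots> = (\<Sum>e\<in>E. measure_pmf.prob p {x. bad e x})"
  proof (rule sum.cong[OF refl])
    fix e
    have "measure_pmf.prob p {x. bad e x} = measure_pmf.prob p ({x. bad e x} \<inter> set_pmf p)"
      by (simp add: measure_Int_set_pmf)
    also have "\<dots> = (\<Sum>x\<in>{x. bad e x} \<inter> set_pmf p. pmf p x)"
      using fin by (intro measure_measure_pmf_finite) auto
    finally show "(\<Sum>x\<in>set_pmf p. if bad e x then pmf p x else 0) = measure_pmf.prob p {x. bad e x}"
      using fin by (simp add: sum.If_cases Int_commute)
  qed
  also have "\<dots> \<le> (\<Sum>e\<in>E. c)" using prob by (rule sum_mono)
  also have "\<dots> = c * card E" by simp
  finally show False by simp
qed

subsection \<open>Distances in subdivided graphs\<close>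

lemma relpow_inv_image:
  "(x, y) \<in> (inv_image R f) ^^ n \<Longrightarrow> (f x, f y) \<in> R ^^ n"
proof (induction n arbitrary: y)
  case (Suc n)
  then obtain z where "(x, z) \<in> inv_image R f ^^ n" "(z, y) \<in> inv_image R f" by auto
  with Suc.IH show ?case by auto
qed simp

lemma subdivision_walk_along_edge:
  assumes "(u, v) \<in> E" "i \<le> t"
  shows "(on_path t u v 0, on_path t u v i) \<in> subdivision t E ^^ i"
  using assms(2)
proof (induction i)
  case (Suc i)
  then have "(on_path t u v i, on_path t u v (Suc i)) \<in> subdivision t E"
    using assms(1) unfolding subdivision_def
    by (intro CollectI exI[of _ u] exI[of _ v] exI[of _ i] exI[of _ "Suc i"]) auto
  with Suc show ?case by auto
qed simp

text \<open>A walk pays \<open>t\<close> steps for each subdivided edge that it traverses, and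
  turning back inside a path gains nothing.\<close>

lemma subdivision_walk_projects:
  assumes "(Branch u, Branch w) \<in> subdivision t E ^^ m" "E \<subseteq> all_edges"
  shows "\<exists>j. j * t \<le> m \<and> (u, w) \<in> (E \<union> E\<inverse>) ^^ j"
proof -
  \<comment> \<open>The invariant after \<open>m\<close> steps: one end of the path holding
    \<open>y\<close> is reached by \<open>j\<close> edges of the base graph, and
    \<open>j * t\<close> plus the distance of \<open>y\<close> from that end is at most
    \<open>m\<close>.\<close>
  define reach where "reach m y = (case y of
      Branch w \<Rightarrow> \<exists>j. j * t \<le> m \<and> (u, w) \<in> (E \<union> E\<inverse>) ^^ j
    | Inner a b i \<Rightarrow> (\<exists>j. j * t + i \<le> m \<and> (u, a) \<in> (E \<union> E\<inverse>) ^^ j) \<or>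
       (\<exists>j. j * t + (t - i) \<le> m \<and> (u, b) \<in> (E \<union> E\<inverse>) ^^ j))" for m y
  \<comment> \<open>The formula for inner vertices stays right at \<open>i = 0\<close> and
    \<open>i = t\<close>: coming along the path from the far end costs \<open>t\<close>, as does one
    more edge of the base graph.\<close>
  have reach_on_path: "reach m (on_path t a b i) \<longleftrightarrow>
      (\<exists>j. j * t + i \<le> m \<and> (u, a) \<in> (E \<union> E\<inverse>) ^^ j) \<or>
      (\<exists>j. j * t + (t - i) \<le> m \<and> (u, b) \<in> (E \<union> E\<inverse>) ^^ j)"
    if ab: "(a, b) \<in> E" "i \<le> t" for a b i m
  proof -
    have step: "\<exists>j. j * t \<le> m \<and> (u, y) \<in> (E \<union> E\<inverse>) ^^ j"
      if "\<exists>j. j * t + t \<le> m \<and> (u, x) \<in> (E \<union> E\<inverse>) ^^ j" "(x, y) \<in> E \<union> E\<inverse>" for x y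
    proof -
      from that obtain j where "j * t + t \<le> m" "(u, x) \<in> (E \<union> E\<inverse>) ^^ j" by blast
      then have "Suc j * t \<le> m" "(u, y) \<in> (E \<union> E\<inverse>) ^^ Suc j" using that(2) by auto
      then show ?thesis by blast
    qed
    consider "i = 0" | "i \<noteq> 0" "i = t" | "i \<noteq> 0" "i \<noteq> t" by blast
    then show ?thesis
    proof cases
      case 1
      then show ?thesis using step[of b a] ab by (auto simp: reach_def on_path_def)
    next
      case 2
      then show ?thesis using step[of a b] ab by (auto simp: reach_def on_path_def)
    next
      case 3
      then show ?thesis by (simp add: reach_def on_path_def)
    qed
  qed
  have "reach m y" if "(Branch u, y) \<in> subdivision t E ^^ m" for y
    using that
  proof (induction m arbitrary: y)
    case 0
    then show ?case by (auto simp: reach_def intro!: exI[of _ 0])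
  next
    case (Suc m)
    then obtain z where z: "reach m z" "(z, y) \<in> subdivision t E" by auto
    from z(2) obtain a b i where ab: "(a, b) \<in> E" "i < t"
      and zy: "z = on_path t a b i \<and> y = on_path t a b (Suc i) \<or>
       y = on_path t a b i \<and> z = on_path t a b (Suc i)"
      by (rule subdivision_cases)
    from zy show ?case
    proof
      assume zy: "z = on_path t a b i \<and> y = on_path t a b (Suc i)"
      then consider j where "j * t + i \<le> m" "(u, a) \<in> (E \<union> E\<inverse>) ^^ j" |
        j where "j * t + (t - i) \<le> m" "(u, b) \<in> (E \<union> E\<inverse>) ^^ j"
        using z(1) reach_on_path[OF ab(1), of i m] ab(2) by auto
      then have "reach (Suc m) (on_path t a b (Suc i))"
      proof cases
        case (1 j) then show ?thesis unfolding reach_on_path[OF ab(1) Suc_leI[OF ab(2)]] by (intro disjI1 exI[of _ j]) auto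
      next
        case (2 j) then show ?thesis unfolding reach_on_path[OF ab(1) Suc_leI[OF ab(2)]] by (intro disjI2 exI[of _ j]) auto
      qed
      with zy show ?thesis by simp
    next
      assume zy: "y = on_path t a b i \<and> z = on_path t a b (Suc i)"
      then consider j where "j * t + Suc i \<le> m" "(u, a) \<in> (E \<union> E\<inverse>) ^^ j" |
        j where "j * t + (t - Suc i) \<le> m" "(u, b) \<in> (E \<union> E\<inverse>) ^^ j"
        using z(1) reach_on_path[OF ab(1), of "Suc i" m] ab(2) by auto
      then have "reach (Suc m) (on_path t a b i)"
      proof cases
        case (1 j) then show ?thesis unfolding reach_on_path[OF ab(1) less_imp_le[OF ab(2)]] by (intro disjI1 exI[of _ j]) auto
      next
        case (2 j) then show ?thesis using ab(2) unfolding reach_on_path[OF ab(1) less_imp_le[OF ab(2)]] by (intro disjI2 exI[of _ j]) auto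
      qed
      with zy show ?thesis by simp
    qed
  qed
  from this[OF assms(1)] show ?thesis by (simp add: reach_def)
qed

text \<open>All numbers below \<open>n\<close> are vertices, whatever \<open>E\<close> is, so that
  the graphs for all subgraphs of one base graph share their vertex set and numbering.\<close>

definition subdivided_graph :: "(label \<Rightarrow> nat) \<Rightarrow> nat \<Rightarrow> nat \<Rightarrow> nat rel \<Rightarrow> nat ugraph" where
  "subdivided_graph h n t E =
     \<lparr>verts = {..<n}, edges = {{h a, h b} |a b. (a, b) \<in> subdivision t E}\<rparr>"

lemma adj_subdivided_graph:
  "adj (subdivided_graph h n t E) = {(h a, h b) |a b. (a, b) \<in> subdivision t E}"
  using sym_subdivision[of t E]
  by (auto simp: adj_def subdivided_graph_def doubleton_eq_iff dest: symD)

context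
  fixes h :: "label \<Rightarrow> nat" and L :: "label set" and n t :: nat and E :: "nat rel"
  assumes h: "bij_betw h L {..<n}" and E: "E \<subseteq> all_edges"
    and L: "subdivision t E \<subseteq> L \<times> L"
begin

lemma adj_subdivided_graph_inv:
  "adj (subdivided_graph h n t E) \<subseteq> inv_image (subdivision t E) (inv_into L h)"
  using h L by (auto simp: adj_subdivided_graph bij_betw_inv_into_left)

lemma finite_simple_subdivided_graph: "finite_simple_graph (subdivided_graph h n t E)"
  unfolding finite_simple_graph_def
proof (intro conjI ballI)
  show "finite (verts (subdivided_graph h n t E))" by (simp add: subdivided_graph_def)
  fix e assume "e \<in> edges (subdivided_graph h n t E)"
  then obtain a b where ab: "(a, b) \<in> subdivision t E" "e = {h a, h b}"
    by (auto simp: subdivided_graph_def)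
  then have "a \<in> L" "b \<in> L" using L by auto
  moreover have "a \<noteq> b"
  proof
    assume "a = b"
    with ab obtain u v i where "(u, v) \<in> E" "i < t" "on_path t u v i = on_path t u v (Suc i)"
      by (metis subdivision_cases)
    then show False using on_path_inject[of u v i t "Suc i"] E by auto
  qed
  ultimately have "h a \<noteq> h b" "h a \<in> {..<n}" "h b \<in> {..<n}"
    using h by (auto simp: bij_betw_def inj_on_def)
  then show "e \<subseteq> verts (subdivided_graph h n t E)" "card e = 2"
    using ab by (auto simp: subdivided_graph_def)
qed

lemma gdist_subdivided_edge:
  assumes "(u, v) \<in> E" "0 < t"
  shows "gdist (subdivided_graph h n t E) (h (Branch u)) (h (Branch v)) \<le> enat t"
proof -
  have "(Branch u, Branch v) \<in> subdivision t E ^^ t"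
    using subdivision_walk_along_edge[OF assms(1), of t t] assms(2) by (simp add: on_path_def)
  moreover have "subdivision t E \<subseteq> inv_image (adj (subdivided_graph h n t E)) h"
    unfolding adj_subdivided_graph inv_image_def by blast
  ultimately have "(h (Branch u), h (Branch v)) \<in> adj (subdivided_graph h n t E) ^^ t"
    using relpow_mono relpow_inv_image by metis
  then show ?thesis by (auto simp: gdist_le_iff)
qed

text \<open>A walk of length \<open>m\<close> projects to a base walk with at most
  \<open>m / t\<close> edges, and that one must have more than \<open>k\<close>. At infinite
  distance there is nothing to project.\<close>

lemma gdist_subdivided_non_edge:
  assumes "Branch u \<in> L" "Branch v \<in> L" "\<And>j. j \<le> k \<Longrightarrow> (u, v) \<notin> (E \<union> E\<inverse>) ^^ j"
    and "\<alpha> < real k + 1" "0 < t"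
  shows "ereal (\<alpha> * real t) < ereal_of_enat (gdist (subdivided_graph h n t E) (h (Branch u)) (h (Branch v)))"
proof (cases "gdist (subdivided_graph h n t E) (h (Branch u)) (h (Branch v))")
  case (enat m)
  then obtain m' where m': "m' \<le> m"
      "(h (Branch u), h (Branch v)) \<in> adj (subdivided_graph h n t E) ^^ m'"
    using gdist_le_iff[of "subdivided_graph h n t E" "h (Branch u)" "h (Branch v)" m] by auto
  have "(Branch u, Branch v) \<in> subdivision t E ^^ m'"
    using relpow_inv_image[OF relpow_mono[OF adj_subdivided_graph_inv m'(2)]] assms(1,2) h
    by (simp add: bij_betw_inv_into_left)
  from subdivision_walk_projects[OF this E] obtain j
    where j: "j * t \<le> m'" "(u, v) \<in> (E \<union> E\<inverse>) ^^ j" by blast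
  have "\<not> j \<le> k" using assms(3) j(2) by blast
  then have "Suc k * t \<le> j * t" by (intro mult_right_mono) auto
  then have "Suc k * t \<le> m" using j m' by linarith
  then have "real (Suc k) * real t \<le> real m" by (metis of_nat_le_iff of_nat_mult)
  moreover have "\<alpha> * real t < real (Suc k) * real t"
    using assms(4,5) by (intro mult_strict_right_mono) auto
  ultimately show ?thesis using enat by simp
qed simp

end

subsection \<open>Sketches recover subgraphs\<close>

lemma exists_label_numbering:
  assumes "N + N ^ 2 * t \<le> n"
  obtains L h where "bij_betw h L {..<n}" "\<And>u. Branch u \<in> L \<longleftrightarrow> u < N"
    "\<And>E. E \<subseteq> {..<N} \<times> {..<N} \<Longrightarrow> subdivision t E \<subseteq> L \<times> L"
proof -
  define L0 where "L0 = Branch ` {..<N} \<union> (\<lambda>(u, v, i). Inner u v i) ` ({..<N} \<times> {..<N} \<times> {..<t})"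
  have fin: "finite L0" by (simp add: L0_def)
  have "card L0 \<le> card (Branch ` {..<N}) + card ((\<lambda>(u, v, i). Inner u v i) ` ({..<N} \<times> {..<N} \<times> {..<t}))"
    unfolding L0_def by (rule card_Un_le)
  also have "\<dots> \<le> card {..<N} + card ({..<N} \<times> {..<N} \<times> {..<t})"
    by (intro add_mono card_image_le) auto
  also have "\<dots> \<le> n" using assms by (simp add: power2_eq_square mult.assoc)
  finally have "card L0 \<le> n" .
  \<comment> \<open>The padding uses positions from \<open>t\<close> on, which are interior to no
    path and do not occur in \<open>L0\<close>; it brings the number of labels to exactly
    \<open>n\<close>.\<close>
  define L where "L = L0 \<union> (\<lambda>j. Inner 0 0 (t + j)) ` {..<n - card L0}"
  have "L0 \<inter> (\<lambda>j. Inner 0 0 (t + j)) ` {..<n - card L0} = {}" by (auto simp: L0_def)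
  then have "card L = card L0 + (n - card L0)"
    unfolding L_def using fin by (subst card_Un_disjoint) (auto simp: card_image inj_on_def)
  then have "card L = card {..<n}" using \<open>card L0 \<le> n\<close> by simp
  moreover have "finite L" using fin by (simp add: L_def)
  ultimately obtain h where h: "bij_betw h L {..<n}"
    using finite_same_card_bij by blast
  have "Branch u \<in> L \<longleftrightarrow> u < N" for u by (auto simp: L_def L0_def)
  moreover have "subdivision t E \<subseteq> L \<times> L" if E: "E \<subseteq> {..<N} \<times> {..<N}" for E
  proof -
    have "on_path t u v i \<in> L" if "(u, v) \<in> E" "i \<le> t" for u v i
    proof -
      have uv: "u < N" "v < N" using E that(1) by auto
      have "Branch u \<in> L" "Branch v \<in> L" using uv by (simp_all add: L_def L0_def)
      moreover have "Inner u v i \<in> (\<lambda>(u, v, i). Inner u v i) ` ({..<N} \<times> {..<N} \<times> {..<t})" if "i < t"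
        by (rule image_eqI[of _ _ "(u, v, i)"]) (use uv that in auto)
      ultimately show ?thesis using that(2) by (auto simp: on_path_def L_def L0_def)
    qed
    then show ?thesis by (auto simp: subdivision_def)
  qed
  ultimately show ?thesis by (rule that[OF h])
qed

text \<open>The factor 52 is 4 times 13: 4 from the density of \<open>R\<close> and from keeping one
  orientation of each edge, 13 from the counting bound.\<close>

theorem sketch_size_lower_bound:
  assumes \<tau>: "0 < \<tau> N" and sketch: "has_ADT_sketch (subdivided_class \<tau>) \<alpha> s"
    and k: "1 \<le> k" "\<alpha> < real k + 1" and N: "2 * (D + 1) ^ k \<le> N"
    and n: "N + N ^ 2 * \<tau> N \<le> n"
  shows "D \<le> 52 * s n"
proof -
  define t where "t = \<tau> N"
  have t: "0 < t" using \<tau> by (simp add: t_def)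
  obtain R where R: "R \<subseteq> {..<N} \<times> {..<N}" "sparse k D R" "D * N \<le> 2 * card R"
    by (rule exists_dense_sparse[OF k(1) N])
  define E where "E = {(u, v) \<in> R. u < v}"
  have E: "E \<subseteq> {..<N} \<times> {..<N}" "E \<subseteq> all_edges" using R by (auto simp: E_def)
  have finE: "finite E" by (rule finite_subset[OF E(1)]) simp
  have "R = E \<union> E\<inverse>"
    using R(2) unfolding sparse_def E_def
    by (auto dest: symD simp: irrefl_def)
  then have "card R \<le> 2 * card E" using card_Un_le[of E "E\<inverse>"] by simp
  then have card_E: "D * N \<le> 4 * card E" using R(3) by linarith
  have n': "N + N ^ 2 * t \<le> n" using n by (simp add: t_def)
  obtain L h where h: "bij_betw h L {..<n}" and L: "\<And>u. Branch u \<in> L \<longleftrightarrow> u < N"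
    "\<And>E. E \<subseteq> {..<N} \<times> {..<N} \<Longrightarrow> subdivision t E \<subseteq> L \<times> L"
    by (rule exists_label_numbering[OF n'], rule that)
  define G where "G Y = subdivided_graph h n t Y" for Y
  have L': "subdivision t Y \<subseteq> L \<times> L" if "Y \<subseteq> E" for Y
    using L(2) E(1) that by blast
  have vG: "verts (G Y) = {..<n}" for Y by (simp add: G_def subdivided_graph_def)
  have hv: "h (Branch u) < n" if "u < N" for u
    using h L(1) that by (auto simp: bij_betw_def)
  have in_class: "G Y \<in> subdivided_class \<tau>" if Y: "Y \<subseteq> E" for Y
  proof -
    have "Y \<subseteq> all_edges" using Y E by blast
    have "adj (G Y) \<subseteq> inv_image (subdivision t Y) (inv_into L h)"
      unfolding G_def by (rule adj_subdivided_graph_inv[OF h \<open>Y \<subseteq> all_edges\<close> L'[OF Y]])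
    also have "inv_image (subdivision t Y) (inv_into L h) \<subseteq> inv_image (subdivision t all_edges) (inv_into L h)"
      using subdivision_mono[OF \<open>Y \<subseteq> all_edges\<close>, of t] by auto
    finally have "adj (G Y) \<subseteq> inv_image (subdivision (\<tau> N) all_edges) (inv_into L h)"
      by (simp add: t_def)
    moreover have "inj_on (inv_into L h) (verts (G Y))"
      using bij_betw_inv_into[OF h] by (simp add: vG bij_betw_def)
    moreover have "\<forall>x\<in>verts (G Y). \<forall>u. inv_into L h x = Branch u \<longrightarrow> u < N"
      using bij_betwE[OF bij_betw_inv_into[OF h]] L(1) by (metis vG)
    moreover have "finite_simple_graph (G Y)"
      unfolding G_def by (rule finite_simple_subdivided_graph[OF h \<open>Y \<subseteq> all_edges\<close> L'[OF Y]])
    ultimately show ?thesis unfolding subdivided_class_def by blast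
  qed
  define W where "W = {w :: bool list. length w = s n}"
  have W: "finite W" "card W = 2 ^ s n"
    using card_lists_length_eq[of "UNIV :: bool set" "s n"] finite_lists_length_eq[of "UNIV :: bool set" "s n"]
    by (auto simp: W_def)
  \<comment> \<open>The decoder for \<open>r = t\<close> is fixed before the subgraph
    \<open>Y\<close>, so \<open>decoded l\<close> depends on \<open>l\<close> alone.\<close>
  obtain dec where dec: "\<forall>H\<in>subdivided_class \<tau>. \<exists>p :: (nat \<Rightarrow> bool list) pmf.
          set_pmf p \<subseteq> verts H \<rightarrow>\<^sub>E {w. length w = s (card (verts H))} \<and>
          (\<forall>x\<in>verts H. \<forall>y\<in>verts H.
             (gdist H x y \<le> enat t \<longrightarrow>
                measure_pmf.prob p {sk. dec (sk x) (sk y)} \<ge> 2/3) \<and>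
             (ereal_of_enat (gdist H x y) > ereal (\<alpha> * real t) \<longrightarrow>
                measure_pmf.prob p {sk. \<not> dec (sk x) (sk y)} \<ge> 2/3))"
    using sketch unfolding has_ADT_sketch_def by blast
  define decoded where "decoded l = {(u, v) \<in> E. dec (l u) (l v)}" for l :: "nat \<Rightarrow> bool list"
  \<comment> \<open>Only the sketches of the \<open>N\<close> branch vertices are recorded, which
    takes \<open>N * s n\<close> bits instead of \<open>n * s n\<close>.\<close>
  define labelings where "labelings = {..<N} \<rightarrow>\<^sub>E W"
  have cover: "\<exists>l\<in>labelings. 3 * card (sym_diff Y (decoded l)) \<le> card E" if Y: "Y \<subseteq> E" for Y
  proof -
    have "\<exists>p :: (nat \<Rightarrow> bool list) pmf. set_pmf p \<subseteq> {..<n} \<rightarrow>\<^sub>E W \<and>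
          (\<forall>x\<in>{..<n}. \<forall>y\<in>{..<n}.
             (gdist (G Y) x y \<le> enat t \<longrightarrow>
                measure_pmf.prob p {sk. dec (sk x) (sk y)} \<ge> 2/3) \<and>
             (ereal_of_enat (gdist (G Y) x y) > ereal (\<alpha> * real t) \<longrightarrow>
                measure_pmf.prob p {sk. \<not> dec (sk x) (sk y)} \<ge> 2/3))"
      using bspec[OF dec in_class[OF Y]] by (simp add: vG W_def)
    then obtain p :: "(nat \<Rightarrow> bool list) pmf" where p: "set_pmf p \<subseteq> {..<n} \<rightarrow>\<^sub>E W"
      and near: "\<And>x y. x < n \<Longrightarrow> y < n \<Longrightarrow> gdist (G Y) x y \<le> enat t \<Longrightarrow>
                measure_pmf.prob p {sk. dec (sk x) (sk y)} \<ge> 2/3"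
      and far: "\<And>x y. x < n \<Longrightarrow> y < n \<Longrightarrow> ereal_of_enat (gdist (G Y) x y) > ereal (\<alpha> * real t) \<Longrightarrow>
                measure_pmf.prob p {sk. \<not> dec (sk x) (sk y)} \<ge> 2/3"
      by auto
    define bad where "bad e sk \<longleftrightarrow>
      dec (sk (h (Branch (fst e)))) (sk (h (Branch (snd e)))) \<noteq> (e \<in> Y)" for e and sk :: "nat \<Rightarrow> bool list"
    have Yall: "Y \<subseteq> all_edges" using Y E by blast
    have good: "measure_pmf.prob p {sk. \<not> bad e sk} \<ge> 2/3" if "e \<in> E" for e
    proof -
      obtain u v where e: "e = (u, v)" by (cases e)
      have uv: "u < N" "v < N" "u < v" "(u, v) \<in> R" using that E e by (auto simp: E_def)
      show ?thesis
      proof (cases "(u, v) \<in> Y")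
        case True
        have "gdist (G Y) (h (Branch u)) (h (Branch v)) \<le> enat t"
          unfolding G_def by (rule gdist_subdivided_edge[OF h Yall L'[OF Y] True t])
        from near[OF hv hv this] show ?thesis using uv True by (simp add: bad_def e)
      next
        case False
        have "(u, v) \<notin> (Y \<union> Y\<inverse>) ^^ j" if "j \<le> k" for j
        proof
          assume walk: "(u, v) \<in> (Y \<union> Y\<inverse>) ^^ j"
          \<comment> \<open>A walk in \<open>Y\<close> avoids the edge between \<open>u\<close> and
            \<open>v\<close> and would close a cycle with it in \<open>R\<close>;
            \<open>sparse\<close> excludes this up to walk length \<open>k\<close>.\<close>
          have "Y \<union> Y\<inverse> \<subseteq> R - {(u, v), (v, u)}"
            using Y False uv(3) \<open>R = E \<union> E\<inverse>\<close> Yall by auto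
          from relpow_mono[OF this walk] show False
            using R(2) uv(4) that unfolding sparse_def by blast
        qed
        then have "ereal (\<alpha> * real t) < ereal_of_enat (gdist (G Y) (h (Branch u)) (h (Branch v)))"
          unfolding G_def using gdist_subdivided_non_edge[OF h Yall L'[OF Y]] L(1) uv k(2) t by blast
        from far[OF hv hv this] show ?thesis using uv False by (simp add: bad_def e)
      qed
    qed
    have compl: "measure_pmf.prob p {sk. \<not> bad e sk} = 1 - measure_pmf.prob p {sk. bad e sk}" for e
      using measure_pmf.prob_compl[of "{sk. bad e sk}" p] by (simp add: Collect_neg_eq Compl_eq_Diff_UNIV)
    have prob: "measure_pmf.prob p {sk. bad e sk} \<le> 1/3" if "e \<in> E" for e
      using good[OF that] compl[of e] by linarith
    have "finite (set_pmf p)" by (rule finite_subset[OF p]) (simp add: finite_PiE W)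
    have "\<exists>sk\<in>set_pmf p. real (card {e \<in> E. bad e sk}) \<le> 1/3 * card E"
      using \<open>finite (set_pmf p)\<close> finE prob by (rule pmf_few_failures)
    then obtain sk where sk: "sk \<in> set_pmf p" "real (card {e \<in> E. bad e sk}) \<le> 1/3 * card E"
      by blast
    define l where "l = (\<lambda>v\<in>{..<N}. sk (h (Branch v)))"
    have "l \<in> labelings"
      using sk(1) p hv by (auto simp: l_def labelings_def PiE_iff)
    moreover have "sym_diff Y (decoded l) = {e \<in> E. bad e sk}"
    proof -
      have "l u = sk (h (Branch u))" "l v = sk (h (Branch v))" if "(u, v) \<in> E" for u v
        using that E(1) by (auto simp: l_def)
      then show ?thesis using Y by (auto simp: decoded_def bad_def)
    qed
    moreover have "3 * card {e \<in> E. bad e sk} \<le> card E" using sk(2) by linarith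
    ultimately show ?thesis by metis
  qed
  have "32 ^ card E \<le> card labelings ^ 3 * 27 ^ card E"
    by (rule covering_bound[OF finE _ _ cover])
      (auto simp: labelings_def decoded_def finite_PiE W)
  moreover have "card labelings = 2 ^ (N * s n)"
    by (simp add: labelings_def card_PiE W(2) mult.commute flip: power_mult)
  ultimately have "card E \<le> 13 * (N * s n)" using covering_bound_bits by simp
  then have "D * N \<le> 52 * (N * s n)" using card_E by linarith
  then have "D * N \<le> 52 * s n * N" by (simp only: ac_simps)
  moreover have "0 < N" using N by (cases N) auto
  ultimately show ?thesis by simp
qed

subsection \<open>The two classes\<close>

text \<open>If \<rho> grows slowly, \<tau> has to grow fast and the graphs become huge, but a
  constant sketch size does not notice.\<close>

lemma not_sketchable_class:
  fixes \<rho> :: "nat \<Rightarrow> nat"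
  assumes \<rho>: "filterlim \<rho> at_top at_top" "\<And>r. 3 \<le> \<rho> r"
  shows "\<exists>F. monotone_class F \<and> expansion_at_most F (\<lambda>r. real (\<rho> r)) \<and> \<not> ADT_sketchable F"
proof -
  have "\<exists>t>0. \<forall>r. t \<le> 6 * r + 2 \<longrightarrow> N + 4 \<le> \<rho> r" for N
  proof -
    obtain r0 where "\<And>r. r0 \<le> r \<Longrightarrow> N + 4 \<le> \<rho> r"
      using \<rho>(1) unfolding filterlim_at_top eventually_sequentially by blast
    \<comment> \<open>With this \<open>t\<close>, \<open>t \<le> 6 * r + 2\<close> forces
      \<open>r0 \<le> r\<close>.\<close>
    then show ?thesis by (intro exI[of _ "6 * r0 + 3"]) auto
  qed
  then obtain \<tau> where \<tau>: "\<And>N. 0 < \<tau> N" "\<And>N r. \<tau> N \<le> 6 * r + 2 \<Longrightarrow> N + 4 \<le> \<rho> r"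
    by metis
  have "expansion_at_most (subdivided_class \<tau>) (\<lambda>r. real (\<rho> r))"
  proof (rule expansion_subdivided_class[OF \<tau>(1)])
    show "3 \<le> real (\<rho> r)" for r using \<rho>(2)[of r] by linarith
    show "real N + 4 \<le> real (\<rho> r)" if "\<tau> N \<le> 6 * r + 2" for N r using \<tau>(2)[OF that] by linarith
  qed
  moreover have "\<not> ADT_sketchable (subdivided_class \<tau>)"
  proof
    assume "ADT_sketchable (subdivided_class \<tau>)"
    then obtain \<alpha> b where \<alpha>: "1 < \<alpha>" "has_ADT_sketch (subdivided_class \<tau>) \<alpha> (\<lambda>_. b)"
      by (auto simp: ADT_sketchable_def)
    define k where "k = nat \<lfloor>\<alpha>\<rfloor>"
    have "1 \<le> k" "\<alpha> < real k + 1" using \<alpha>(1) by (auto simp: k_def le_nat_floor)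
    \<comment> \<open>\<open>N\<close> and \<open>n\<close> take the least values allowed, and
      \<open>D = 52 * b + 1\<close> contradicts the bound.\<close>
    from sketch_size_lower_bound[OF \<tau>(1) \<alpha>(2) this order_refl order_refl, of "52 * b + 1"]
    show False by simp
  qed
  ultimately show ?thesis using monotone_subdivided_class by blast
qed

text \<open>With \<open>\<tau> N\<close> about \<open>N powr (1 / \<epsilon>)\<close> the expansion
  is of order \<open>r powr \<epsilon>\<close>, while \<open>n\<close> stays polynomial in
  \<open>N\<close>. So \<open>D\<close>, about \<open>N powr (1 / k)\<close>, is a power of
  \<open>n\<close> with exponent of order \<open>1 / \<alpha>\<close>.\<close>

lemma polynomial_sketch_class:
  fixes \<epsilon> :: real
  assumes \<epsilon>: "0 < \<epsilon>"
  shows "\<exists>F. monotone_class F \<and>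
           (\<exists>f :: nat \<Rightarrow> real. f \<in> O(\<lambda>r. real r powr \<epsilon>) \<and> expansion_at_most F f) \<and>
           (\<exists>c :: real. c > 0 \<and>
              (\<forall>\<alpha> :: real. \<forall>s :: nat \<Rightarrow> nat. \<alpha> \<ge> 1 \<and> has_ADT_sketch F \<alpha> s \<longrightarrow>
                 (\<forall>\<^sub>F n in sequentially. real (s n) \<ge> real n powr (c / \<alpha>))))"
proof -
  define q where "q = nat \<lceil>1 / \<epsilon>\<rceil>"
  \<comment> \<open>The summand 1 keeps \<open>\<tau> 0\<close> positive.\<close>
  define \<tau> where "\<tau> N = N ^ q + 1" for N :: nat
  define f where "f r = 4 + (6 * real r + 2) powr \<epsilon>" for r :: nat
  have q: "1 / \<epsilon> \<le> real q" unfolding q_def by (rule real_nat_ceiling_ge)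
  have f: "real N + 4 \<le> f r" if "\<tau> N \<le> 6 * r + 2" for N r
  proof (cases "N = 0")
    case False
    have "real (N ^ q) \<le> real (6 * r + 2)" using that unfolding \<tau>_def of_nat_le_iff by linarith
    moreover have "real N powr (1 / \<epsilon>) \<le> real N powr real q" using False q by (intro powr_mono) auto
    ultimately have "real N powr (1 / \<epsilon>) \<le> 6 * real r + 2" using False by (simp add: powr_realpow)
    then have "(real N powr (1 / \<epsilon>)) powr \<epsilon> \<le> (6 * real r + 2) powr \<epsilon>"
      using \<epsilon> by (intro powr_mono2) auto
    then show ?thesis using False \<epsilon> by (simp add: f_def powr_powr)
  qed (simp add: f_def)
  have "3 \<le> f r" for r by (simp add: f_def add_increasing2)
  then have "expansion_at_most (subdivided_class \<tau>) f"
    using f by (intro expansion_subdivided_class) (auto simp: \<tau>_def)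
  moreover have "f \<in> O(\<lambda>r. real r powr \<epsilon>)"
    unfolding f_def using \<epsilon> by real_asymp
  moreover have "\<forall>\<^sub>F n in sequentially. real n powr (1 / (2 * (real q + 4)) / \<alpha>) \<le> real (s n)"
    if \<alpha>: "1 \<le> \<alpha>" and sketch: "has_ADT_sketch (subdivided_class \<tau>) \<alpha> s" for \<alpha> s
  proof -
    define k where "k = nat \<lfloor>\<alpha>\<rfloor>"
    have k: "1 \<le> k" "\<alpha> < real k + 1" "real k \<le> \<alpha>" using \<alpha> by (auto simp: k_def le_nat_floor)
    \<comment> \<open>About \<open>N ^ (q + 2)\<close> vertices are needed; \<open>q + 4\<close> in
      place of \<open>q + 2\<close> leaves room for the factor 3 below.\<close>
    define \<beta> where "\<beta> = 1 / (real q + 4)"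
    define \<delta> where "\<delta> = 1 / real k"
    have \<beta>: "0 < \<beta>" by (simp add: \<beta>_def add_nonneg_pos)
    have \<delta>: "0 < \<delta>" using k by (simp add: \<delta>_def)
    have "\<beta> * (real q + 2) < 1" by (simp add: \<beta>_def divide_less_eq)
    then have "\<forall>\<^sub>F n in sequentially. 3 * real n powr (\<beta> * (real q + 2)) \<le> real n"
      by real_asymp
    moreover have "\<forall>\<^sub>F n in sequentially. 3 \<le> real n powr \<beta>"
      using \<beta> by real_asymp
    \<comment> \<open>Halving the exponent absorbs the constants. The threshold for \<open>n\<close>
      may depend on \<alpha>, the final constant \<open>c\<close> may not.\<close>
    moreover have "\<forall>\<^sub>F n in sequentially.
        52 * real n powr (\<beta> * \<delta> / 2) + 2 \<le> ((real n powr \<beta> - 1) / 2) powr \<delta>"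
      using \<beta> \<delta> by real_asymp
    moreover have "\<forall>\<^sub>F n in sequentially. 1 \<le> n" by (rule eventually_ge_at_top)
    ultimately show ?thesis
    proof eventually_elim
      case (elim n)
      define N where "N = nat \<lfloor>real n powr \<beta>\<rfloor>"
      have N: "real N \<le> real n powr \<beta>" "real n powr \<beta> - 1 \<le> real N"
        unfolding N_def using of_nat_floor[of "real n powr \<beta>"] by (simp, linarith)
      then have "2 \<le> real N" using elim(2) by linarith
      then have "2 \<le> N" by simp
      have "N ^ 1 \<le> N ^ (q + 2)" "N ^ 2 \<le> N ^ (q + 2)"
        using \<open>2 \<le> N\<close> by (intro power_increasing; simp)+
      moreover have "N + N ^ 2 * \<tau> N = N ^ 1 + N ^ 2 + N ^ (q + 2)"
        by (simp add: \<tau>_def power_add power2_eq_square algebra_simps)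
      ultimately have "N + N ^ 2 * \<tau> N \<le> 3 * N ^ (q + 2)" by linarith
      moreover have "real (N ^ (q + 2)) \<le> real n powr (\<beta> * (real q + 2))"
      proof -
        have "real (N ^ (q + 2)) = real N powr (real q + 2)"
          using \<open>2 \<le> N\<close> by (simp add: powr_add powr_realpow power_add power2_eq_square)
        also have "\<dots> \<le> (real n powr \<beta>) powr (real q + 2)"
          using N by (intro powr_mono2) auto
        finally show ?thesis by (simp add: powr_powr)
      qed
      ultimately have "real (N + N ^ 2 * \<tau> N) \<le> real n" using elim(1) by linarith
      then have n: "N + N ^ 2 * \<tau> N \<le> n" by (simp only: of_nat_le_iff)
      \<comment> \<open>Subtracting 1 yields \<open>(D + 1) ^ k \<le> N / 2\<close>; the floor is at
        least 1 because \<open>2 \<le> N\<close>, so the subtraction is not truncated.\<close>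
      define D where "D = nat \<lfloor>(real N / 2) powr \<delta>\<rfloor> - 1"
      have "1 \<le> (real N / 2) powr \<delta>" using \<open>2 \<le> real N\<close> \<delta> by (simp add: ge_one_powr_ge_zero)
      then have D: "real D + 1 \<le> (real N / 2) powr \<delta>" "(real N / 2) powr \<delta> - 2 \<le> real D"
        unfolding D_def using of_nat_floor[of "(real N / 2) powr \<delta>"]
        by (simp_all add: le_nat_floor of_nat_diff) linarith+
      have "(real D + 1) ^ k \<le> ((real N / 2) powr \<delta>) ^ k"
        using D(1) by (intro power_mono) auto
      also have "\<dots> = real N / 2"
        using k(1) \<open>2 \<le> N\<close> by (simp add: \<delta>_def powr_powr flip: powr_realpow)
      finally have "real (2 * (D + 1) ^ k) \<le> real N" by (simp add: add.commute)
      then have "2 * (D + 1) ^ k \<le> N" by (simp only: of_nat_le_iff)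
      from sketch_size_lower_bound[OF _ sketch k(1,2) this n]
      have "real D \<le> 52 * real (s n)" by (simp add: \<tau>_def)
      moreover have "((real n powr \<beta> - 1) / 2) powr \<delta> \<le> (real N / 2) powr \<delta>"
        using N(2) elim(2) \<delta> by (intro powr_mono2) auto
      ultimately have "real n powr (\<beta> * \<delta> / 2) \<le> real (s n)"
        using D(2) elim(3) by linarith
      moreover have "1 / (2 * (real q + 4)) / \<alpha> = \<beta> * (1 / \<alpha>) / 2" by (simp add: \<beta>_def)
      \<comment> \<open>As \<open>k\<close> is the floor of \<alpha>, passing from
        \<open>1 / k\<close> to \<open>1 / \<alpha>\<close> only weakens the bound.\<close>
      moreover have "1 / \<alpha> \<le> \<delta>" using k by (simp add: \<delta>_def frac_le)
      then have "\<beta> * (1 / \<alpha>) / 2 \<le> \<beta> * \<delta> / 2" using \<beta> by (intro divide_right_mono mult_left_mono) auto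
      then have "real n powr (\<beta> * (1 / \<alpha>) / 2) \<le> real n powr (\<beta> * \<delta> / 2)"
        using elim(4) by (intro powr_mono) auto
      ultimately show ?case by simp
    qed
  qed
  ultimately show ?thesis
    using monotone_subdivided_class
    by (intro exI[of _ "subdivided_class \<tau>"] conjI exI[of _ f] exI[of _ "1 / (2 * (real q + 4))"]) auto
qed

theorem theorem5p13:
  "(\<forall>\<rho> :: nat \<Rightarrow> nat. filterlim \<rho> at_top at_top \<and> (\<forall>r. \<rho> r \<ge> 3) \<longrightarrow>
      (\<exists>F. monotone_class F \<and> expansion_at_most F (\<lambda>r. real (\<rho> r)) \<and> \<not> ADT_sketchable F))
   \<and>
   (\<forall>\<epsilon> :: real. \<epsilon> > 0 \<longrightarrow>
      (\<exists>F. monotone_class F \<and>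
           (\<exists>f :: nat \<Rightarrow> real. f \<in> O(\<lambda>r. real r powr \<epsilon>) \<and> expansion_at_most F f) \<and>
           (\<exists>c :: real. c > 0 \<and>
              (\<forall>\<alpha> :: real. \<forall>s :: nat \<Rightarrow> nat. \<alpha> \<ge> 1 \<and> has_ADT_sketch F \<alpha> s \<longrightarrow>
                 (\<forall>\<^sub>F n in sequentially. real (s n) \<ge> real n powr (c / \<alpha>))))))"
  using not_sketchable_class polynomial_sketch_class by blast

end
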